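(* Let $V:[-1,1]\times[t_0,t_1]\to so(3)$ be a variation through Lie quadratics of the nonzero constant $V_0=D$, as specified in the context, with associated $d=\|D\|$, $F_0$, $\tilde e$, $q(t)=c_0+c_1(t-t_0)+c_2(t-t_0)^2$ and $A_0,A_1,B\in F_0^\perp$, and let $\delta\in(0,1)$. The second order approximate quadratic of $V$ is $$\hat V_2(t)=D+\delta\big(q(t)F_0+A_0+(t-t_0)A_1+\tilde e(t)(B)\big)+\frac{\delta^2}{2}\big(f_2(t)F_0+v_2(t)\big),$$ where $$f_2=-2\langle[A_0,L_0(B)]+[A_1,L_1(B)],F_0\rangle,$$ $$v_2=2q^{(2)}\big(M_0(A_0)+M_1(A_1)-M_B(B)\big)+2d^2\,\tilde i\circ I^2(I(q)\tilde e)(B),$$ and, with $u:=d(t-t_0)$, $\mathbf 1$ the identity on $so(3)$, and $\tilde e$ evaluated at $t$, $$L_0=\tfrac1d\big(-u\mathbf 1+(u^2/2-1)\tilde i+\tilde i\circ\tilde e\big),\qquad L_1=\tfrac1{d^2}\big((u^2/2-3)\mathbf 1+2u\tilde i+3\tilde e+u\,\tilde i\circ\tilde e\big),$$ $$M_0=\tfrac1{d^3}\big((u^2/2-1)\mathbf 1+u\tilde i+\tilde e\big),\qquad M_1=\tfrac1{d^4}\big((u^3/6-u)\mathbf 1+(u^2/2-1)\tilde i+\tilde i\circ\tilde e\big),$$ $$M_B=\tfrac1{d^3}\big(2(\tilde e-\mathbf 1)+u\,\tilde i\circ(\tilde e+\mathbf 1)\big).$$ For every integer $j\ge0$ and all $t\in[t_0,t_1]$,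 $$V_\delta^{(j)}(t)=\hat V_2^{(j)}(t)+O(\delta^3),$$ where the asymptotic constants depend only on $d,t_0,t_1$ and $j$.
   Context: Superscript $(j)$ denotes the $j$-th derivative in $t$; for a function of $(h,t)$, $V^{(i,j)}$ denotes $i$ derivatives in $h$ and $j$ in $t$. Throughout $t_0<t_1$. Euclidean space $E^3$ is a Lie algebra with the cross product; the isomorphism $\mathrm{ad}:E^3\to so(3)$, $\mathrm{ad}(v)(w)=v\times w$, identifies $E^3$ with $so(3)$, and $so(3)$ carries the inner product $\langle\,,\rangle$ making $\mathrm{ad}$ an isometry. A smooth curve $U:[t_0,t_1]\to so(3)$ is a Lie quadratic when $U^{(2)}=[U^{(1)},U]+C$ for some constant $C\in so(3)$ (equivalently $U^{(3)}=[U^{(2)},U]$). Variation. $V:[-1,1]\times[t_0,t_1]\to so(3)$ is $C^\infty$; $V_h:=V(h,\cdot)$ is a Lie quadratic for every $h\in[-1,1]$; $V_0$ is a nonzero constant $D$; and $h\mapsto V(h,t_0)$ is an affine function of uniform norm $\le 1$. Notation. $d:=\|D\|$, $F_0:=D/d$, $F_0^\perp$ is the orthogonal complement of $F_0$ in $so(3)$; $\tilde i:=\mathrm{ad}(F_0)=[F_0,\cdot]$ and $\tilde e(t):=\exp(-d(t-t_0)\,\tilde i)$, linear endomorphisms of $so(3)$. The constants $c_0,c_1,c_2\in\mathbb{R}$ and $A_0,A_1,B\in F_0^\perp$ are those determined by $$V^{(1,0)}(0,t)=q(t)F_0+A_0+(t-t_0)A_1+\tilde e(t)(B),\qquad q(t)=c_0+c_1(t-t_0)+c_2(t-t_0)^2.$$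 For a continuous (scalar-, vector- or endomorphism-valued) function $g$ on $[t_0,t_1]$, $I(g)(t):=\int_{t_0}^tg(s)\,ds$ and $I^2(g):=I(I(g))$. Second order approximate quadratic: for $\delta\in(0,1)$, $\hat V_2(t):=V_0(t)+\delta V^{(1,0)}(0,t)+\frac{\delta^2}{2}V^{(2,0)}(0,t)$.
   Formalization: The formal theorem requires not only V(h,t_0) but also V^{(0,1)}(h,t_0) and V^{(0,2)}(h,t_0) to be affine in h with uniform norm at most 1; otherwise V = D + K h^2 (t-t_0) D refutes the formula, and its h^3 analogue refutes the uniform O(δ^3) bound. *)

theory Defs
  imports "HOL-Analysis.Analysis"
begin

section \<open>The Euclidean Lie algebra $so(3)$\<close>

typedef so3 = "{M :: real^3^3. transpose M = - M}"
  by (rule exI[of _ 0]) (simp add: transpose_def vec_eq_iff)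

definition bracket :: "so3 \<Rightarrow> so3 \<Rightarrow> so3"
  where "bracket X Y = Abs_so3 (Rep_so3 X ** Rep_so3 Y - Rep_so3 Y ** Rep_so3 X)"

definition ad_iso :: "real^3 \<Rightarrow> so3"
  where "ad_iso v = Abs_so3 (matrix (\<lambda>w. cross3 v w))"

lemma skew_iff: "transpose M = - M \<longleftrightarrow> (\<forall>i j. M $ i $ j = - M $ j $ i)"
  for M :: "real^3^3"
  by (auto simp: transpose_def vec_eq_iff)

lemma matrix_cross3_skew: "transpose (matrix (cross3 v)) = - matrix (cross3 v)"
  by (auto simp: skew_iff matrix_def forall_3 cross_components axis_def)

lemma Rep_ad_iso: "Rep_so3 (ad_iso v) = matrix (cross3 v)"
  by (simp add: ad_iso_def Abs_so3_inverse matrix_cross3_skew)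

lemma bij_ad_iso: "bij ad_iso"
proof (rule bijI')
  fix v w :: "real^3"
  have "v = w" if "matrix (cross3 v) = matrix (cross3 w)"
    using that by (auto simp: vec_eq_iff matrix_def forall_3 cross_components axis_def)
  then show "ad_iso v = ad_iso w \<longleftrightarrow> v = w"
    by (metis Rep_ad_iso)
next
  fix X :: so3
  define M where "M = Rep_so3 X"
  have skew: "M $ i $ j = - M $ j $ i" for i j
    using Rep_so3[of X] unfolding M_def mem_Collect_eq skew_iff by blast
  have "M $ 1 $ 1 = 0" "M $ 2 $ 2 = 0" "M $ 3 $ 3 = 0"
    "M $ 1 $ 2 = - M $ 2 $ 1" "M $ 2 $ 3 = - M $ 3 $ 2" "M $ 3 $ 1 = - M $ 1 $ 3"
    using skew[of 1 1] skew[of 2 2] skew[of 3 3] skew[of 1 2] skew[of 2 3] skew[of 3 1]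
    by linarith+
  then have "M = matrix (cross3 (vector [M $ 3 $ 2, M $ 1 $ 3, M $ 2 $ 1]))"
    by (simp add: vec_eq_iff matrix_def forall_3 cross_components axis_def)
  then show "\<exists>v. X = ad_iso v"
    by (metis M_def Rep_ad_iso Rep_so3_inject)
qed

lemma ad_iso_inv [simp]: "ad_iso (inv ad_iso X) = X" "inv ad_iso (ad_iso v) = v"
  using bij_ad_iso by (simp_all add: bij_is_surj surj_f_inv_f bij_is_inj)

instantiation so3 :: real_vector
begin
definition "0 = Abs_so3 0"
definition "X + Y = Abs_so3 (Rep_so3 X + Rep_so3 Y)"
definition "X - Y = Abs_so3 (Rep_so3 X - Rep_so3 Y)"
definition "- X = Abs_so3 (- Rep_so3 X)"
definition "r *\<^sub>R X = Abs_so3 (r *\<^sub>R Rep_so3 X)"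

lemma transpose_Rep_so3: "transpose (Rep_so3 X) = - Rep_so3 X"
  using Rep_so3[of X] by simp

lemma transpose_linear:
  "transpose (M + N) = transpose M + transpose N" "transpose (M - N) = transpose M - transpose N"
  "transpose (- M) = - transpose M" "transpose (r *\<^sub>R M) = r *\<^sub>R transpose M"
  for M N :: "real^3^3"
  by (simp_all add: transpose_def vec_eq_iff)

lemma Rep_so3_simps:
  "Rep_so3 0 = 0" "Rep_so3 (X + Y) = Rep_so3 X + Rep_so3 Y"
  "Rep_so3 (X - Y) = Rep_so3 X - Rep_so3 Y" "Rep_so3 (- X) = - Rep_so3 X"
  "Rep_so3 (r *\<^sub>R X) = r *\<^sub>R Rep_so3 X"
  unfolding zero_so3_def plus_so3_def minus_so3_def uminus_so3_def scaleR_so3_def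
  by (simp_all add: Abs_so3_inverse transpose_linear transpose_Rep_so3)
     (simp add: Abs_so3_inverse transpose_def vec_eq_iff)

instance
  by standard (simp_all add: Rep_so3_simps algebra_simps flip: Rep_so3_inject)
end

lemma Rep_bracket: "Rep_so3 (bracket X Y) = Rep_so3 X ** Rep_so3 Y - Rep_so3 Y ** Rep_so3 X"
proof -
  have "transpose (Rep_so3 X ** Rep_so3 Y - Rep_so3 Y ** Rep_so3 X)
      = - (Rep_so3 X ** Rep_so3 Y - Rep_so3 Y ** Rep_so3 X)"
    unfolding transpose_linear matrix_transpose_mul transpose_Rep_so3
    by (simp add: matrix_matrix_mult_def vec_eq_iff)
  then show ?thesis
    by (simp add: bracket_def Abs_so3_inverse)
qed

lemma linear_ad_iso: "linear ad_iso"
proof (rule linearI)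
  fix v w :: "real^3" and r :: real
  show "ad_iso (v + w) = ad_iso v + ad_iso w"
    by (simp add: Rep_so3_simps Rep_ad_iso matrix_def vec_eq_iff cross_add_left
        flip: Rep_so3_inject)
  show "ad_iso (r *\<^sub>R v) = r *\<^sub>R ad_iso v"
    by (simp add: Rep_so3_simps Rep_ad_iso matrix_def vec_eq_iff cross_mult_left
        flip: Rep_so3_inject)
qed

lemma bracket_ad_iso: "bracket (ad_iso v) (ad_iso w) = ad_iso (cross3 v w)"
proof -
  have "Rep_so3 (bracket (ad_iso v) (ad_iso w)) = matrix (cross3 (cross3 v w))"
    unfolding Rep_bracket Rep_ad_iso
    by (simp add: vec_eq_iff matrix_matrix_mult_def matrix_def forall_3 sum_3
        cross_components axis_def)
  then show ?thesis
    by (metis Rep_ad_iso Rep_so3_inject)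
qed

lemma linear_inv_ad_iso: "linear (inv ad_iso)"
proof (rule linearI)
  fix X Y :: so3 and r :: real
  have inj: "v = w" if "ad_iso v = ad_iso w" for v w
    using that bij_ad_iso by (meson bij_is_inj injD)
  show "inv ad_iso (X + Y) = inv ad_iso X + inv ad_iso Y"
    by (rule inj) (simp only: linear_add[OF linear_ad_iso] ad_iso_inv)
  show "inv ad_iso (r *\<^sub>R X) = r *\<^sub>R inv ad_iso X"
    by (rule inj) (simp only: linear_scale[OF linear_ad_iso] ad_iso_inv)
qed

text \<open>The inner product is the one making \<^const>\<open>ad_iso\<close> an isometry; it is half of the
  Frobenius product of matrices.\<close>

instantiation so3 :: real_inner
begin
definition "inner X Y = inner (inv ad_iso X) (inv ad_iso Y)"
definition "norm (X :: so3) = sqrt (inner X X)"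
definition "dist X (Y :: so3) = norm (X - Y)"
definition "sgn (X :: so3) = X /\<^sub>R norm X"
definition "(uniformity :: (so3 \<times> so3) filter) = (INF e\<in>{0<..}. principal {(x, y). dist x y < e})"
definition "open (U :: so3 set) \<longleftrightarrow>
  (\<forall>x\<in>U. eventually (\<lambda>(x', y). x' = x \<longrightarrow> y \<in> U) uniformity)"

instance
proof
  fix X Y Z :: so3 and r :: real
  have "X = 0" if "inv ad_iso X = 0"
    using ad_iso_inv(1)[of X] that linear_0[OF linear_ad_iso] by simp
  then show "inner X X = 0 \<longleftrightarrow> X = 0"
    unfolding inner_so3_def inner_eq_zero_iff
    using linear_0[OF linear_inv_ad_iso] by blast
qed (simp_all add: inner_so3_def norm_so3_def dist_so3_def sgn_so3_def uniformity_so3_def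
      open_so3_def inner_commute linear_add[OF linear_inv_ad_iso]
      linear_scale[OF linear_inv_ad_iso] inner_add_right)
end

instantiation so3 :: euclidean_space
begin
definition "Basis = ad_iso ` Basis"

instance
proof
  fix X Y :: so3
  show "inner X Y = (if X = Y then 1 else 0)" if XY: "X \<in> Basis" "Y \<in> Basis"
  proof -
    obtain v w where "v \<in> Basis" "w \<in> Basis" "X = ad_iso v" "Y = ad_iso w"
      using XY by (auto simp: Basis_so3_def)
    then show ?thesis
      using bij_ad_iso by (auto simp: inner_so3_def inner_Basis bij_is_inj inj_eq)
  qed
  have "(\<forall>u\<in>Basis. inner X u = 0) \<longleftrightarrow> inv ad_iso X = 0"
    by (simp add: Basis_so3_def inner_so3_def euclidean_all_zero_iff)
  also have "\<dots> \<longleftrightarrow> inner X X = 0"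
    unfolding inner_so3_def by simp
  finally show "(\<forall>u\<in>Basis. inner X u = 0) \<longleftrightarrow> X = 0"
    by simp
qed (simp_all add: Basis_so3_def)
end

lift_definition ad_op :: "so3 \<Rightarrow> so3 \<Rightarrow>\<^sub>L so3" is bracket
proof -
  fix X :: so3
  have "linear (bracket X)"
    by (rule linearI)
       (simp_all add: Rep_so3_simps Rep_bracket matrix_matrix_mult_def vec_eq_iff
         sum.distrib sum_distrib_left algebra_simps flip: Rep_so3_inject)
  then show "bounded_linear (bracket X)"
    by (rule linear_conv_bounded_linear[THEN iffD1])
qed

text \<open>The exponential series, convergent in operator norm; there is no ring structure on
  \<^typ>\<open>'a \<Rightarrow>\<^sub>L 'a\<close> that would give access to \<^const>\<open>exp\<close>.\<close>

definition blinfun_exp :: "('a::real_normed_vector \<Rightarrow>\<^sub>L 'a) \<Rightarrow> 'a \<Rightarrow>\<^sub>L 'a"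
  where "blinfun_exp T = (\<Sum>n. (1 / fact n) *\<^sub>R ((\<lambda>S. T o\<^sub>L S) ^^ n) id_blinfun)"


section \<open>Smooth curves and variations\<close>

text \<open>Derivatives are one-sided at the boundary.\<close>

definition curve_deriv ::
    "real \<Rightarrow> real \<Rightarrow> nat \<Rightarrow> (real \<Rightarrow> 'a::real_normed_vector) \<Rightarrow> real \<Rightarrow> 'a"
  where "curve_deriv t0 t1 j =
    (\<lambda>U t. vector_derivative U (at t within {t0..t1})) ^^ j"

definition smooth_curve :: "real \<Rightarrow> real \<Rightarrow> (real \<Rightarrow> 'a::real_normed_vector) \<Rightarrow> bool"
  where "smooth_curve t0 t1 U \<longleftrightarrow>
    (\<forall>j. \<forall>t\<in>{t0..t1}. curve_deriv t0 t1 j U differentiable (at t within {t0..t1}))"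

definition partial_h :: "(real \<Rightarrow> real \<Rightarrow> 'a::real_normed_vector) \<Rightarrow> real \<Rightarrow> real \<Rightarrow> 'a"
  where "partial_h V h t = vector_derivative (\<lambda>x. V x t) (at h within {-1..1})"

definition partial_t ::
    "real \<Rightarrow> real \<Rightarrow> (real \<Rightarrow> real \<Rightarrow> 'a::real_normed_vector) \<Rightarrow> real \<Rightarrow> real \<Rightarrow> 'a"
  where "partial_t t0 t1 V h t = vector_derivative (V h) (at t within {t0..t1})"

fun C_class ::
    "real \<Rightarrow> real \<Rightarrow> nat \<Rightarrow> (real \<Rightarrow> real \<Rightarrow> 'a::real_normed_vector) \<Rightarrow> bool"
  where
    "C_class t0 t1 0 V \<longleftrightarrow> continuous_on ({-1..1} \<times> {t0..t1}) (\<lambda>(h, t). V h t)"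
  | "C_class t0 t1 (Suc k) V \<longleftrightarrow>
      (\<forall>h\<in>{-1..1}. \<forall>t\<in>{t0..t1}.
        (\<lambda>x. V x t) differentiable (at h within {-1..1}) \<and>
        V h differentiable (at t within {t0..t1})) \<and>
      C_class t0 t1 k (partial_h V) \<and> C_class t0 t1 k (partial_t t0 t1 V)"

definition smooth_variation ::
    "real \<Rightarrow> real \<Rightarrow> (real \<Rightarrow> real \<Rightarrow> 'a::real_normed_vector) \<Rightarrow> bool"
  where "smooth_variation t0 t1 V \<longleftrightarrow> (\<forall>k. C_class t0 t1 k V)"

text \<open>\<open>V\<close> differentiated \<open>i\<close> times in \<open>h\<close> and \<open>j\<close> times in \<open>t\<close>.\<close>

definition mixed_deriv ::
    "real \<Rightarrow> real \<Rightarrow> nat \<Rightarrow> nat \<Rightarrow> (real \<Rightarrow> real \<Rightarrow> 'a::real_normed_vector) \<Rightarrow> real \<Rightarrow> real \<Rightarrow> 'a"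
  where "mixed_deriv t0 t1 i j V = (partial_h ^^ i) ((partial_t t0 t1 ^^ j) V)"


section \<open>Variations through Lie quadratics\<close>

definition lie_quadratic :: "real \<Rightarrow> real \<Rightarrow> (real \<Rightarrow> so3) \<Rightarrow> bool"
  where "lie_quadratic t0 t1 U \<longleftrightarrow> smooth_curve t0 t1 U \<and>
    (\<exists>C. \<forall>t\<in>{t0..t1}.
      curve_deriv t0 t1 2 U t = bracket (curve_deriv t0 t1 1 U t) (U t) + C)"

definition affine_norm_le_1 :: "(real \<Rightarrow> 'a::real_normed_vector) \<Rightarrow> bool"
  where "affine_norm_le_1 g \<longleftrightarrow>
    (\<exists>a b. \<forall>h\<in>{-1..1}. g h = a + h *\<^sub>R b) \<and> (\<forall>h\<in>{-1..1}. norm (g h) \<le> 1)"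

text \<open>A Lie quadratic solves the third order equation \<open>U''' = [U'', U]\<close>, so its data at \<open>t0\<close>
  are the values there of \<open>U\<close>, \<open>U'\<close> and \<open>U''\<close>. The condition that the initial data depend
  affinely on \<open>h\<close>, with uniform norm at most 1, is imposed on all three. For the values of \<open>V\<close>
  alone it would not determine the second derivative of \<open>V\<close> in \<open>h\<close>, nor give uniform bounds:
  consider \<open>V h t = D + (K * h^2 * (t - t0)) *\<^sub>R D\<close>.\<close>

definition lie_quadratic_variation :: "real \<Rightarrow> real \<Rightarrow> (real \<Rightarrow> real \<Rightarrow> so3) \<Rightarrow> so3 \<Rightarrow> bool"
  where "lie_quadratic_variation t0 t1 V D \<longleftrightarrow>
    smooth_variation t0 t1 V \<and>
    (\<forall>h\<in>{-1..1}. lie_quadratic t0 t1 (V h)) \<and>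
    D \<noteq> 0 \<and> (\<forall>t\<in>{t0..t1}. V 0 t = D) \<and>
    (\<forall>j\<le>2. affine_norm_le_1 (\<lambda>h. mixed_deriv t0 t1 0 j V h t0))"

definition V_hat2 :: "real \<Rightarrow> real \<Rightarrow> (real \<Rightarrow> real \<Rightarrow> so3) \<Rightarrow> real \<Rightarrow> real \<Rightarrow> so3"
  where "V_hat2 t0 t1 V \<delta> t =
    V 0 t + \<delta> *\<^sub>R mixed_deriv t0 t1 1 0 V 0 t + (\<delta>\<^sup>2 / 2) *\<^sub>R mixed_deriv t0 t1 2 0 V 0 t"


section \<open>The closed form\<close>

definition F0 :: "so3 \<Rightarrow> so3"
  where "F0 D = D /\<^sub>R norm D"

definition F0_perp :: "so3 \<Rightarrow> so3 set"
  where "F0_perp D = {X. inner X (F0 D) = 0}"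

definition i_til :: "so3 \<Rightarrow> so3 \<Rightarrow>\<^sub>L so3"
  where "i_til D = ad_op (F0 D)"

definition e_til :: "so3 \<Rightarrow> real \<Rightarrow> real \<Rightarrow> so3 \<Rightarrow>\<^sub>L so3"
  where "e_til D t0 t = blinfun_exp (- (norm D * (t - t0)) *\<^sub>R i_til D)"

definition q_poly :: "real \<Rightarrow> real \<Rightarrow> real \<Rightarrow> real \<Rightarrow> real \<Rightarrow> real"
  where "q_poly c0 c1 c2 t0 t = c0 + c1 * (t - t0) + c2 * (t - t0)\<^sup>2"

definition first_variation ::
    "so3 \<Rightarrow> real \<Rightarrow> (real \<Rightarrow> real) \<Rightarrow> so3 \<Rightarrow> so3 \<Rightarrow> so3 \<Rightarrow> real \<Rightarrow> so3"
  where "first_variation D t0 q A0 A1 B t =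
    q t *\<^sub>R F0 D + A0 + (t - t0) *\<^sub>R A1 + blinfun_apply (e_til D t0 t) B"

definition I_op :: "real \<Rightarrow> (real \<Rightarrow> 'a::real_normed_vector) \<Rightarrow> real \<Rightarrow> 'a"
  where "I_op t0 g t = integral {t0..t} g"

definition L0 :: "so3 \<Rightarrow> real \<Rightarrow> real \<Rightarrow> so3 \<Rightarrow>\<^sub>L so3"
  where "L0 D t0 t = (let d = norm D; u = d * (t - t0); i = i_til D; e = e_til D t0 t in
    (1 / d) *\<^sub>R (- u *\<^sub>R id_blinfun + (u\<^sup>2 / 2 - 1) *\<^sub>R i + (i o\<^sub>L e)))"

definition L1 :: "so3 \<Rightarrow> real \<Rightarrow> real \<Rightarrow> so3 \<Rightarrow>\<^sub>L so3"
  where "L1 D t0 t = (let d = norm D; u = d * (t - t0); i = i_til D; e = e_til D t0 t in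
    (1 / d\<^sup>2) *\<^sub>R
      ((u\<^sup>2 / 2 - 3) *\<^sub>R id_blinfun + (2 * u) *\<^sub>R i + 3 *\<^sub>R e + u *\<^sub>R (i o\<^sub>L e)))"

definition M0 :: "so3 \<Rightarrow> real \<Rightarrow> real \<Rightarrow> so3 \<Rightarrow>\<^sub>L so3"
  where "M0 D t0 t = (let d = norm D; u = d * (t - t0); i = i_til D; e = e_til D t0 t in
    (1 / d ^ 3) *\<^sub>R ((u\<^sup>2 / 2 - 1) *\<^sub>R id_blinfun + u *\<^sub>R i + e))"

definition M1 :: "so3 \<Rightarrow> real \<Rightarrow> real \<Rightarrow> so3 \<Rightarrow>\<^sub>L so3"
  where "M1 D t0 t = (let d = norm D; u = d * (t - t0); i = i_til D; e = e_til D t0 t in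
    (1 / d ^ 4) *\<^sub>R
      ((u ^ 3 / 6 - u) *\<^sub>R id_blinfun + (u\<^sup>2 / 2 - 1) *\<^sub>R i + (i o\<^sub>L e)))"

definition M_B :: "so3 \<Rightarrow> real \<Rightarrow> real \<Rightarrow> so3 \<Rightarrow>\<^sub>L so3"
  where "M_B D t0 t = (let d = norm D; u = d * (t - t0); i = i_til D; e = e_til D t0 t in
    (1 / d ^ 3) *\<^sub>R (2 *\<^sub>R (e - id_blinfun) + u *\<^sub>R (i o\<^sub>L (e + id_blinfun))))"

definition f2 :: "so3 \<Rightarrow> real \<Rightarrow> so3 \<Rightarrow> so3 \<Rightarrow> so3 \<Rightarrow> real \<Rightarrow> real"
  where "f2 D t0 A0 A1 B t =
    - 2 * inner (bracket A0 (blinfun_apply (L0 D t0 t) B)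
               + bracket A1 (blinfun_apply (L1 D t0 t) B)) (F0 D)"

definition v2 ::
    "so3 \<Rightarrow> real \<Rightarrow> real \<Rightarrow> (real \<Rightarrow> real) \<Rightarrow> so3 \<Rightarrow> so3 \<Rightarrow> so3 \<Rightarrow> real \<Rightarrow> so3"
  where "v2 D t0 t1 q A0 A1 B t =
    (2 * curve_deriv t0 t1 2 q t) *\<^sub>R
      (blinfun_apply (M0 D t0 t) A0 + blinfun_apply (M1 D t0 t) A1 - blinfun_apply (M_B D t0 t) B)
    + (2 * (norm D)\<^sup>2) *\<^sub>R blinfun_apply
        (i_til D o\<^sub>L I_op t0 (I_op t0 (\<lambda>s. I_op t0 q s *\<^sub>R e_til D t0 s)) t) B"

end

theory Submission
  imports Defs
begin

text \<open>Write \<open>V\<^sub>h = D + h W + (h\<^sup>2 / 2) Z + R\<^sub>h\<close>, where \<open>W\<close> and \<open>Z\<close> are \<^emph>\<open>defined\<close> as the solutions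
  of the first and second linearisation \<open>W''' = [W'', D]\<close>, \<open>Z''' = [Z'', D] + 2 [W'', W]\<close> of
  \<open>U''' = [U'', U]\<close> with the right initial data. Along a solution of \<open>f''' = [f'', A] + S\<close> the norm
  of \<open>f''\<close> grows only through \<open>S\<close>, because \<open>[f'', A]\<close> is orthogonal to \<open>f''\<close>; applied in turn to
  \<open>V\<^sub>h\<close>, \<open>V\<^sub>h - D\<close>, \<open>V\<^sub>h - D - h W\<close> and \<open>R\<^sub>h\<close>, this bounds them, with all their derivatives in \<open>t\<close>, by
  constants times \<open>1\<close>, \<open>h\<close>, \<open>h\<^sup>2\<close> and \<open>h\<^sup>3\<close>. These bounds force \<open>W\<close> and \<open>Z\<close> to be the first two
  derivatives of \<open>V\<close> in \<open>h\<close> at \<open>0\<close>, so that no interchange of partial derivatives is needed. The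
  closed forms are then verified by substituting them into the linearised equations.\<close>

section \<open>Calculus of smooth curves on a compact interval\<close>

text \<open>The error constant has to serve all variations at once, so each estimate fixes its
  constant before the variation, from \<open>t0\<close>, \<open>t1\<close> and \<open>j\<close>
  alone. This works because the initial data in \<open>t\<close>, their slopes in h and
  \<open>norm D\<close> are all at most 1.

  For V_h itself the coefficient of the equation is the unknown curve, which looks circular. The
  bound on orders 0 to 2 does not involve the coefficient, and a bound of order j on the coefficient
  gives order j + 3 of the solution, so the orders can be climbed.

  The linearised equations need no existence theorem. The three scalars and three vectors of the
  plane \<open>F0_perp D\<close> in \<open>first_variation\<close> are nine real parameters, exactly
  enough for arbitrary values of W, W' and W'' at \<open>t0\<close>. The initial data of Z vanish,
  because those of V are affine in h. The source 2 [W'', W] is a sum of elementary terms, and Z is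
  the superposition of the responses to them: each operator L0, L1, M0, M1, M_B and the iterated
  integral is the response to one term.\<close>

locale time_interval =
  fixes t0 t1 :: real
  assumes t0_less_t1: "t0 < t1"
begin

abbreviation cd :: "nat \<Rightarrow> (real \<Rightarrow> 'a::real_normed_vector) \<Rightarrow> real \<Rightarrow> 'a"
  where "cd \<equiv> curve_deriv t0 t1"

abbreviation smooth :: "(real \<Rightarrow> 'a::real_normed_vector) \<Rightarrow> bool"
  where "smooth \<equiv> smooth_curve t0 t1"

abbreviation derivs_to :: "(real \<Rightarrow> 'a::real_normed_vector) \<Rightarrow> (real \<Rightarrow> 'a) \<Rightarrow> bool"
  where "derivs_to f f' \<equiv> \<forall>t\<in>{t0..t1}. (f has_vector_derivative f' t) (at t within {t0..t1})"

lemma vector_derivative_eq: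
  assumes "(f has_vector_derivative f') (at t within {t0..t1})" "t \<in> {t0..t1}"
  shows "vector_derivative f (at t within {t0..t1}) = f'"
  using vector_derivative_within_cbox[of t0 t1 t f f'] t0_less_t1 assms by simp

lemma curve_deriv_0 [simp]: "cd 0 f = f"
  by (simp add: curve_deriv_def)

lemma curve_deriv_Suc: "cd (Suc j) f t = vector_derivative (cd j f) (at t within {t0..t1})"
  by (simp add: curve_deriv_def)

lemma curve_deriv_add: "cd (i + j) f = cd i (cd j f)"
  by (simp add: curve_deriv_def funpow_add)

lemma smooth_curve_deriv: "smooth f \<Longrightarrow> smooth (cd j f)"
  unfolding smooth_curve_def by (simp flip: curve_deriv_add)

lemma derivs_to_cong:
  assumes "derivs_to f f'" "\<And>t. t \<in> {t0..t1} \<Longrightarrow> f t = g t" "\<And>t. t \<in> {t0..t1} \<Longrightarrow> f' t = g' t"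
  shows "derivs_to g g'"
  using assms by (metis has_vector_derivative_transform)

lemma derivs_to_curve_deriv: "smooth f \<Longrightarrow> derivs_to (cd j f) (cd (Suc j) f)"
  unfolding smooth_curve_def by (auto simp: curve_deriv_Suc vector_derivative_works)

lemma derivs_to_eq: "derivs_to f f' \<Longrightarrow> t \<in> {t0..t1} \<Longrightarrow> cd (Suc 0) f t = f' t"
  by (simp add: curve_deriv_Suc vector_derivative_eq)

lemma vector_derivative_cong:
  assumes "\<And>t. t \<in> {t0..t1} \<Longrightarrow> f t = g t" "t \<in> {t0..t1}"
  shows "vector_derivative f (at t within {t0..t1}) = vector_derivative g (at t within {t0..t1})"
proof -
  have "(f has_vector_derivative y) (at t within {t0..t1})
      \<longleftrightarrow> (g has_vector_derivative y) (at t within {t0..t1})" for y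
    using assms by (metis has_vector_derivative_transform)
  then show ?thesis
    by (simp add: vector_derivative_def)
qed

lemma curve_deriv_cong:
  assumes "\<And>t. t \<in> {t0..t1} \<Longrightarrow> f t = g t"
  shows "t \<in> {t0..t1} \<Longrightarrow> cd j f t = cd j g t"
proof (induction j arbitrary: t)
  case 0
  then show ?case
    using assms by simp
next
  case (Suc j)
  then show ?case
    unfolding curve_deriv_Suc by (intro vector_derivative_cong)
qed

lemma smooth_cong:
  assumes "smooth f" "\<And>t. t \<in> {t0..t1} \<Longrightarrow> f t = g t"
  shows "smooth g"
proof -
  have "cd j g differentiable (at t within {t0..t1})" if t: "t \<in> {t0..t1}" for j t
    by (rule differentiableI_vector[of _ "cd (Suc j) f t"],
        rule has_vector_derivative_transform[OF t _ bspec[OF derivs_to_curve_deriv[OF assms(1)] t]])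
       (rule curve_deriv_cong, use assms in auto)
  then show ?thesis
    by (simp add: smooth_curve_def)
qed

text \<open>Exhibiting the whole sequence of derivatives yields smoothness and the values of
  \<open>cd\<close> together. Equality is claimed on the interval only: elsewhere the one-sided
  derivative carries no information.\<close>

lemma jet:
  assumes "\<And>j. derivs_to (F j) (F (Suc j))"
  shows jet_smooth: "smooth (F 0)"
    and jet_curve_deriv: "t \<in> {t0..t1} \<Longrightarrow> cd j (F 0) t = F j t"
proof -
  have eq: "cd j (F 0) t = F j t" if "t \<in> {t0..t1}" for j t
    using that
  proof (induction j arbitrary: t)
    case (Suc j)
    have "cd (Suc j) (F 0) t = vector_derivative (F j) (at t within {t0..t1})"
      unfolding curve_deriv_Suc using Suc by (intro vector_derivative_cong) auto
    also have "\<dots> = F (Suc j) t"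
      using assms[of j] Suc.prems by (intro vector_derivative_eq) auto
    finally show ?case .
  qed simp
  then show "t \<in> {t0..t1} \<Longrightarrow> cd j (F 0) t = F j t" .
  have "cd j (F 0) differentiable (at t within {t0..t1})" if t: "t \<in> {t0..t1}" for j t
    by (rule differentiableI_vector[of _ "F (Suc j) t"],
        rule has_vector_derivative_transform[OF t _ bspec[OF assms t]]) (rule eq)
  then show "smooth (F 0)"
    by (simp add: smooth_curve_def)
qed

section \<open>Closure of smooth curves under linear and bilinear operations\<close>

lemma
  assumes "smooth f" "smooth g"
  shows smooth_add: "smooth (\<lambda>t. f t + g t)"
    and curve_deriv_plus: "t \<in> {t0..t1} \<Longrightarrow> cd j (\<lambda>t. f t + g t) t = cd j f t + cd j g t"
proof -
  have "derivs_to (\<lambda>t. cd j f t + cd j g t) (\<lambda>t. cd (Suc j) f t + cd (Suc j) g t)" for j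
    using derivs_to_curve_deriv[OF assms(1), of j] derivs_to_curve_deriv[OF assms(2), of j]
    by (auto intro: derivative_intros)
  from jet[of "\<lambda>j t. cd j f t + cd j g t", OF this]
  show "smooth (\<lambda>t. f t + g t)"
    "t \<in> {t0..t1} \<Longrightarrow> cd j (\<lambda>t. f t + g t) t = cd j f t + cd j g t"
    by simp_all
qed

lemma (in -) derivs_to_linear:
  assumes "bounded_linear L" "\<forall>t\<in>T. (f has_vector_derivative f' t) (at t within T)"
  shows "\<forall>t\<in>T. ((\<lambda>t. L (f t)) has_vector_derivative L (f' t)) (at t within T)"
  using assms by (auto intro: bounded_linear.has_vector_derivative)

lemma
  assumes "bounded_linear L" "smooth f"
  shows smooth_linear: "smooth (\<lambda>t. L (f t))"
    and curve_deriv_linear: "t \<in> {t0..t1} \<Longrightarrow> cd j (\<lambda>t. L (f t)) t = L (cd j f t)"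
  using jet[of "\<lambda>j t. L (cd j f t)",
      OF derivs_to_linear[OF assms(1) derivs_to_curve_deriv[OF assms(2)]]]
  by simp_all

lemma
  shows smooth_const: "smooth (\<lambda>t. c)"
    and curve_deriv_const: "t \<in> {t0..t1} \<Longrightarrow> cd j (\<lambda>t. c) t = (if j = 0 then c else 0)"
  using jet[of "\<lambda>j t. if j = 0 then c else 0"] by (auto intro: derivative_intros)

lemma smooth_scaleR: "smooth f \<Longrightarrow> smooth (\<lambda>t. c *\<^sub>R f t)"
  by (rule smooth_linear[OF bounded_linear_scaleR_right])

lemma curve_deriv_scaleR:
  "smooth f \<Longrightarrow> t \<in> {t0..t1} \<Longrightarrow> cd j (\<lambda>t. c *\<^sub>R f t) t = c *\<^sub>R cd j f t"
  by (rule curve_deriv_linear[OF bounded_linear_scaleR_right])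

lemma
  assumes "smooth f" "smooth g"
  shows smooth_diff: "smooth (\<lambda>t. f t - g t)"
    and curve_deriv_diff: "t \<in> {t0..t1} \<Longrightarrow> cd j (\<lambda>t. f t - g t) t = cd j f t - cd j g t"
  using smooth_add[OF assms(1) smooth_scaleR[OF assms(2), of "-1"]]
    curve_deriv_plus[OF assms(1) smooth_scaleR[OF assms(2), of "-1"]]
    curve_deriv_scaleR[OF assms(2), of _ _ "-1"]
  by simp_all

text \<open>Choosing a derivative inside the class \<open>Q\<close> for each member and iterating
  the choice produces the sequence required by \<open>jet\<close>.\<close>

lemma smooth_coinduct:
  assumes "Q f" and step: "\<And>g. Q g \<Longrightarrow> \<exists>g'. Q g' \<and> derivs_to g g'"
  shows "smooth f"
proof -
  obtain next_deriv where nd: "\<And>g. Q g \<Longrightarrow> Q (next_deriv g) \<and> derivs_to g (next_deriv g)"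
    using step by metis
  define F where "F j = (next_deriv ^^ j) f" for j
  have Q: "Q (F j)" for j
    by (induction j) (use assms(1) nd in \<open>auto simp: F_def\<close>)
  have "derivs_to (F j) (F (Suc j))" for j
    using nd[OF Q[of j]] by (simp add: F_def)
  from jet_smooth[of F, OF this] show ?thesis
    by (simp add: F_def)
qed

context
  fixes pr :: "'a::real_normed_vector \<Rightarrow> 'b::real_normed_vector \<Rightarrow> 'c::real_normed_vector"
  assumes bilinear: "bounded_bilinear pr"
begin

lemma derivs_to_bilinear:
  assumes "derivs_to f f'" "derivs_to g g'"
  shows "derivs_to (\<lambda>t. pr (f t) (g t)) (\<lambda>t. pr (f t) (g' t) + pr (f' t) (g t))"
  using assms bilinear by (auto intro: bounded_bilinear.has_vector_derivative)

text \<open>Finite sums of terms \<open>pr (cd i f t) (cd k g t)\<close> are closed under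
  differentiation. Indexing them by a list that keeps repeated pairs avoids binomial
  coefficients.\<close>

lemma smooth_bilinear:
  assumes "smooth f" "smooth g"
  shows "smooth (\<lambda>t. pr (f t) (g t))"
proof -
  define S where "S xs = (\<lambda>t. \<Sum>(i, k)\<leftarrow>xs. pr (cd i f t) (cd k g t))" for xs
  define step where "step = concat \<circ> map (\<lambda>(i, k). [(i, Suc k), (Suc i, k)])"
  have "derivs_to (S xs) (S (step xs))" for xs
  proof (induction xs)
    case Nil
    then show ?case
      by (auto simp: S_def step_def intro: derivative_intros)
  next
    case (Cons x xs)
    obtain i k where x: "x = (i, k)"
      by (cases x)
    have "derivs_to (\<lambda>t. pr (cd i f t) (cd k g t))
        (\<lambda>t. pr (cd i f t) (cd (Suc k) g t) + pr (cd (Suc i) f t) (cd k g t))"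
      by (rule derivs_to_bilinear) (rule derivs_to_curve_deriv, rule assms)+
    then have "derivs_to (\<lambda>t. pr (cd i f t) (cd k g t) + S xs t)
        (\<lambda>t. pr (cd i f t) (cd (Suc k) g t) + pr (cd (Suc i) f t) (cd k g t) + S (step xs) t)"
      using Cons by (auto intro!: has_vector_derivative_add)
    then show ?case
      by (simp add: S_def step_def x add.assoc)
  qed
  then have "smooth (S [(0, 0)])"
    by (intro smooth_coinduct[of "\<lambda>f. \<exists>xs. f = S xs"]) auto
  then show ?thesis
    by (simp add: S_def)
qed

end

section \<open>Uniform bounds on all derivatives up to a given order\<close>

definition derivs_le :: "nat \<Rightarrow> real \<Rightarrow> (real \<Rightarrow> 'a::real_normed_vector) \<Rightarrow> bool"
  where "derivs_le j C f \<longleftrightarrow> (\<forall>i\<le>j. \<forall>t\<in>{t0..t1}. norm (cd i f t) \<le> C)"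

lemma derivs_leD: "derivs_le j C f \<Longrightarrow> i \<le> j \<Longrightarrow> t \<in> {t0..t1} \<Longrightarrow> norm (cd i f t) \<le> C"
  by (simp add: derivs_le_def)

lemma derivs_le_nonneg: "derivs_le j C f \<Longrightarrow> 0 \<le> C"
  using order_trans[OF norm_ge_zero derivs_leD[of j C f 0 t0]] t0_less_t1 by simp

lemma derivs_le_mono: "derivs_le j C f \<Longrightarrow> i \<le> j \<Longrightarrow> C \<le> C' \<Longrightarrow> derivs_le i C' f"
  unfolding derivs_le_def by (meson order_trans)

lemma derivs_le_lower: "derivs_le j C f \<Longrightarrow> i \<le> j \<Longrightarrow> derivs_le i C f"
  by (simp add: derivs_le_def)

lemma derivs_le_curve_deriv: "derivs_le (i + j) C f \<Longrightarrow> derivs_le i C (cd j f)"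
  by (simp add: derivs_le_def flip: curve_deriv_add)

lemma derivs_le_Suc:
  "derivs_le (Suc j) C f \<longleftrightarrow> derivs_le j C f \<and> (\<forall>t\<in>{t0..t1}. norm (cd (Suc j) f t) \<le> C)"
  by (auto simp: derivs_le_def le_Suc_eq)

lemma derivs_le_add:
  assumes "smooth f" "smooth g" "derivs_le j C f" "derivs_le j C' g"
  shows "derivs_le j (C + C') (\<lambda>t. f t + g t)"
  using assms by (auto simp: derivs_le_def curve_deriv_plus intro!: norm_triangle_mono)

lemma derivs_le_scaleR:
  assumes "smooth f" "derivs_le j C f"
  shows "derivs_le j (\<bar>c\<bar> * C) (\<lambda>t. c *\<^sub>R f t)"
  using assms by (auto simp: derivs_le_def curve_deriv_scaleR intro!: mult_left_mono)

lemma derivs_le_const: "norm c \<le> C \<Longrightarrow> derivs_le j C (\<lambda>t. c)"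
  using norm_ge_zero[of c] by (auto simp: derivs_le_def curve_deriv_const simp del: norm_ge_zero)

text \<open>The factor \<open>2 ^ j\<close> counts the terms of the uncollected Leibniz rule. The
  induction varies \<open>f\<close> and \<open>g\<close>, since each step replaces one of them by
  its derivative.\<close>

lemma derivs_le_bilinear:
  assumes pr: "bounded_bilinear pr" "\<And>x y. norm (pr x y) \<le> norm x * norm y"
    and "smooth f" "smooth g" "derivs_le j C f" "derivs_le j C' g"
  shows "derivs_le j (2 ^ j * (C * C')) (\<lambda>t. pr (f t) (g t))"
proof -
  have C: "0 \<le> C" and C': "0 \<le> C'"
    using assms(5,6) by (auto dest: derivs_le_nonneg)
  have le: "norm (cd i (\<lambda>t. pr (f t) (g t)) t) \<le> 2 ^ i * (C * C')"
    if "smooth f" "smooth g" "derivs_le i C f" "derivs_le i C' g" "t \<in> {t0..t1}" for i f g t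
    using that
  proof (induction i arbitrary: f g)
    case 0
    then have "norm (f t) \<le> C" "norm (g t) \<le> C'"
      by (auto simp: derivs_le_def)
    then have "norm (f t) * norm (g t) \<le> C * C'"
      using C by (intro mult_mono) auto
    then show ?case
      using pr(2) by (auto intro: order_trans)
  next
    case (Suc i)
    let ?f = "cd (Suc 0) f" and ?g = "cd (Suc 0) g"
    have smooth': "smooth ?f" "smooth ?g"
      using Suc.prems by (simp_all add: smooth_curve_deriv)
    have le': "derivs_le i C ?f" "derivs_le i C' ?g"
      using Suc.prems by (simp_all add: derivs_le_curve_deriv)
    have "derivs_to (\<lambda>t. pr (f t) (g t)) (\<lambda>t. pr (f t) (?g t) + pr (?f t) (g t))"
      using derivs_to_bilinear[OF pr(1) derivs_to_curve_deriv[OF Suc.prems(1), of 0]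
          derivs_to_curve_deriv[OF Suc.prems(2), of 0]] by simp
    then have "cd (Suc i) (\<lambda>t. pr (f t) (g t)) t = cd i (\<lambda>t. pr (f t) (?g t) + pr (?f t) (g t)) t"
      unfolding curve_deriv_add[of i 1, simplified] using Suc.prems(5)
      by (intro curve_deriv_cong derivs_to_eq)
    also have "\<dots> = cd i (\<lambda>t. pr (f t) (?g t)) t + cd i (\<lambda>t. pr (?f t) (g t)) t"
      using Suc.prems smooth' by (intro curve_deriv_plus smooth_bilinear[OF pr(1)])
    also have "norm \<dots> \<le> 2 ^ i * (C * C') + 2 ^ i * (C * C')"
      using Suc.prems smooth' le'
      by (intro norm_triangle_mono Suc.IH) (auto simp: derivs_le_Suc)
    finally show ?case
      by (simp add: algebra_simps)
  qed
  show ?thesis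
    unfolding derivs_le_def
  proof (intro allI impI ballI)
    fix i t assume i: "i \<le> j" and t: "t \<in> {t0..t1}"
    have "norm (cd i (\<lambda>t. pr (f t) (g t)) t) \<le> 2 ^ i * (C * C')"
      using i t assms(3,4) derivs_le_mono[OF assms(5) i] derivs_le_mono[OF assms(6) i]
      by (intro le) simp_all
    also have "\<dots> \<le> 2 ^ j * (C * C')"
      using i C C' by (intro mult_right_mono power_increasing) auto
    finally show "norm (cd i (\<lambda>t. pr (f t) (g t)) t) \<le> 2 ^ j * (C * C')" .
  qed
qed

lemma derivs_to_continuous: "derivs_to f f' \<Longrightarrow> continuous_on {t0..t1} f"
  by (auto simp: continuous_on_eq_continuous_within intro: has_vector_derivative_continuous)

lemma derivs_to_I_op:
  fixes g :: "real \<Rightarrow> 'a::banach"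
  shows "continuous_on {t0..t1} g \<Longrightarrow> derivs_to (I_op t0 g) g"
  unfolding I_op_def by (auto intro: integral_has_vector_derivative)

lemma I_op_t0 [simp]: "I_op t0 g t0 = 0"
  by (simp add: I_op_def)

lemma derivs_to_add:
  "derivs_to f f' \<Longrightarrow> derivs_to g g' \<Longrightarrow> derivs_to (\<lambda>t. f t + g t) (\<lambda>t. f' t + g' t)"
  by (auto intro: has_vector_derivative_add)

lemma norm_le_of_deriv_le:
  assumes "derivs_to f f'" "\<And>t. t \<in> {t0..t1} \<Longrightarrow> norm (f' t) \<le> C" "t \<in> {t0..t1}"
  shows "norm (f t) \<le> norm (f t0) + C * (t1 - t0)"
proof -
  have "norm (f t - f t0) \<le> norm (t - t0) * C"
  proof -
    have "norm (f t - f t0) \<le> C * norm (t - t0)"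
    proof (rule differentiable_bound[of "{t0..t1}"])
      fix s assume s: "s \<in> {t0..t1}"
      show "(f has_derivative (\<lambda>x. x *\<^sub>R f' s)) (at s within {t0..t1})"
        using assms(1) s by (simp add: has_vector_derivative_def)
      show "onorm (\<lambda>x. x *\<^sub>R f' s) \<le> C"
        using assms(2)[OF s] by (intro onorm_le) (simp add: mult.commute[of C] mult_left_mono)
    qed (use assms in auto)
    then show ?thesis
      by (simp add: mult.commute)
  qed
  also have "\<dots> \<le> (t1 - t0) * C"
    using order_trans[OF norm_ge_zero assms(2)[OF assms(3)]] assms(3) by (intro mult_right_mono) auto
  finally show ?thesis
    using norm_triangle_sub[of "f t" "f t0"] by (simp add: mult.commute)
qed

end

section \<open>The bracket as a cross product\<close>

lemma inv_ad_iso_bracket: "inv ad_iso (bracket X Y) = cross3 (inv ad_iso X) (inv ad_iso Y)"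
  by (metis ad_iso_inv bracket_ad_iso)

lemma so3_eq_iff: "X = Y \<longleftrightarrow> inv ad_iso X = inv ad_iso Y"
  by (metis ad_iso_inv(1))

lemmas inv_ad_iso_simps =
  inv_ad_iso_bracket linear_add[OF linear_inv_ad_iso] linear_scale[OF linear_inv_ad_iso]
  linear_diff[OF linear_inv_ad_iso] linear_neg[OF linear_inv_ad_iso] linear_0[OF linear_inv_ad_iso]

text \<open>The squared norm of a cross product is the product of the squared norms minus the
  squared inner product. The constant 1 keeps later bounds free of extra factors.\<close>

lemma norm_bracket_le: "norm (bracket X Y) \<le> norm X * norm Y"
proof -
  have "(norm (cross3 v w))\<^sup>2 \<le> (norm v * norm w)\<^sup>2" for v w
    unfolding norm_cross power_mult_distrib by simp
  then have "norm (cross3 v w) \<le> norm v * norm w" for v w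
    by (rule power2_le_imp_le) simp
  then show ?thesis
    by (simp add: norm_so3_def inner_so3_def inv_ad_iso_bracket flip: norm_eq_sqrt_inner)
qed

lemma bounded_bilinear_bracket: "bounded_bilinear bracket"
proof
  show "\<exists>K. \<forall>X Y. norm (bracket X Y) \<le> norm X * norm Y * K"
    using norm_bracket_le by (intro exI[of _ 1]) simp
qed (simp_all add: so3_eq_iff inv_ad_iso_simps cross_add_left cross_add_right cross_mult_left
    cross_mult_right)

interpretation bracket: bounded_bilinear bracket
  by (rule bounded_bilinear_bracket)

lemma bracket_self [simp]: "bracket X X = 0"
  by (simp add: so3_eq_iff inv_ad_iso_simps)

lemma bracket_skew: "bracket X Y = - bracket Y X"
  by (simp add: so3_eq_iff inv_ad_iso_simps cross_skew[of "inv ad_iso X"])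

lemma inner_bracket_self [simp]:
  "inner (bracket X Y) X = 0" "inner (bracket X Y) Y = 0"
  "inner X (bracket X Y) = 0" "inner Y (bracket X Y) = 0"
  by (simp_all add: inner_so3_def inv_ad_iso_bracket dot_cross_self inner_commute)

text \<open>The triple product expansion, carried over by the isometry; it governs the square of the
  operator \<open>i\<close> and brackets of vectors orthogonal to D.\<close>

lemma bracket_bracket: "bracket X (bracket Y Z) = inner X Z *\<^sub>R Y - inner X Y *\<^sub>R Z"
  by (simp add: so3_eq_iff inv_ad_iso_simps inner_so3_def Lagrange)


section \<open>Estimates for the linearised equation\<close>

context time_interval
begin

lemmas smooth_bracket = smooth_bilinear[OF bounded_bilinear_bracket]

lemmas derivs_le_bracket = derivs_le_bilinear[OF bounded_bilinear_bracket norm_bracket_le]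

text \<open>Taking the inner product with \<open>G\<close> kills the bracket term, so no Gronwall argument is needed
  and the bound does not involve \<open>A\<close>.\<close>

lemma norm_le_of_bracket_ode:
  assumes G: "derivs_to G (\<lambda>t. bracket (G t) (A t) + S t)"
    and S: "\<And>t. t \<in> {t0..t1} \<Longrightarrow> norm (S t) \<le> C" and "t \<in> {t0..t1}"
  shows "norm (G t) \<le> norm (G t0) + 2 * C * (t1 - t0)"
proof -
  have "continuous_on {t0..t1} G"
    using G by (rule derivs_to_continuous)
  then have "continuous_on {t0..t1} (\<lambda>t. norm (G t))"
    by (rule continuous_on_norm)
  \<comment> \<open>Evaluating at a maximum of the norm turns the bound on its square into a
    quadratic inequality for the maximum itself. The norm, possibly not differentiable at zeros of
    \<open>G\<close>, is never differentiated.\<close>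
  then obtain s where s: "s \<in> {t0..t1}" and max: "\<And>t. t \<in> {t0..t1} \<Longrightarrow> norm (G t) \<le> norm (G s)"
    using continuous_attains_sup[of "{t0..t1}" "\<lambda>t. norm (G t)"] t0_less_t1 by auto
  let ?M = "norm (G s)" and ?T = "t1 - t0"
  have C: "0 \<le> C"
    using S[OF s] norm_ge_zero by (rule order_trans[rotated])
  have "derivs_to (\<lambda>t. inner (G t) (G t)) (\<lambda>t. 2 * inner (S t) (G t))"
  proof
    fix t assume t: "t \<in> {t0..t1}"
    have "((\<lambda>t. inner (G t) (G t)) has_vector_derivative
        inner (G t) (bracket (G t) (A t) + S t) + inner (bracket (G t) (A t) + S t) (G t))
        (at t within {t0..t1})"
      using G t by (intro bounded_bilinear.has_vector_derivative[OF bounded_bilinear_inner]) auto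
    then show "((\<lambda>t. inner (G t) (G t)) has_vector_derivative 2 * inner (S t) (G t))
        (at t within {t0..t1})"
      by (simp add: inner_add_left inner_add_right inner_commute)
  qed
  moreover have "norm (2 * inner (S t) (G t)) \<le> 2 * (C * ?M)" if t: "t \<in> {t0..t1}" for t
  proof -
    have "\<bar>inner (S t) (G t)\<bar> \<le> norm (S t) * norm (G t)"
      by (rule Cauchy_Schwarz_ineq2)
    also have "\<dots> \<le> C * ?M"
      using S[OF t] max[OF t] C by (intro mult_mono) auto
    finally show ?thesis
      by (simp add: abs_mult)
  qed
  ultimately have "norm (inner (G s) (G s)) \<le> norm (inner (G t0) (G t0)) + 2 * (C * ?M) * ?T"
    using s by (intro norm_le_of_deriv_le)
  then have "?M\<^sup>2 \<le> (norm (G t0))\<^sup>2 + 2 * (C * ?T) * ?M"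
    by (simp add: power2_norm_eq_inner algebra_simps)
  \<comment> \<open>Completing the square: (m - c)^2 is at most g^2 + c^2, hence at most (g +
    c)^2.\<close>
  moreover have "m \<le> g + 2 * c" if "m\<^sup>2 \<le> g\<^sup>2 + 2 * c * m" "0 \<le> g" "0 \<le> c" for m g c :: real
  proof -
    have "0 \<le> g * c"
      using that by simp
    then have "(m - c)\<^sup>2 \<le> (g + c)\<^sup>2"
      using that(1) by (simp add: power2_eq_square algebra_simps)
    then have "m - c \<le> g + c"
      by (rule power2_le_imp_le) (use that in simp)
    then show ?thesis
      by simp
  qed
  moreover have "0 \<le> C * ?T"
    using C t0_less_t1 by simp
  ultimately have "?M \<le> norm (G t0) + 2 * (C * ?T)"
    by simp
  then show ?thesis
    using max[OF assms(3)] by simp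
qed

text \<open>Separating the coefficient \<open>A\<close> and the source \<open>S\<close> from
  \<open>f\<close> lets one estimate cover the nonlinear equation (\<open>A\<close> =
  \<open>f\<close>), the difference to D (\<open>A\<close> = V_h) and the linearisations
  (\<open>A\<close> = D).\<close>

definition lie_ode :: "(real \<Rightarrow> so3) \<Rightarrow> (real \<Rightarrow> so3) \<Rightarrow> (real \<Rightarrow> so3) \<Rightarrow> bool"
  where "lie_ode f A S \<longleftrightarrow> smooth f \<and> smooth A \<and> smooth S \<and>
    (\<forall>t\<in>{t0..t1}. cd 3 f t = bracket (cd 2 f t) (A t) + S t)"

definition init_le :: "real \<Rightarrow> (real \<Rightarrow> so3) \<Rightarrow> bool"
  where "init_le r f \<longleftrightarrow> (\<forall>i\<le>2. norm (cd i f t0) \<le> r)"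

text \<open>Each order costs one factor 1 + 2 (t1 - t0): the energy bound gives f'', and two
  integrations from \<open>t0\<close> give f' and f.\<close>

lemma lie_ode_derivs_le_2:
  assumes "lie_ode f A S" "init_le r f" "derivs_le 0 r S"
  shows "derivs_le 2 ((1 + 2 * (t1 - t0)) ^ 3 * r) f"
proof -
  define E where "E = 1 + 2 * (t1 - t0)"
  have E: "1 \<le> E" and E_eq: "2 * (t1 - t0) = E - 1"
    using t0_less_t1 by (auto simp: E_def)
  have f: "smooth f" and ode: "\<And>t. t \<in> {t0..t1} \<Longrightarrow> cd 3 f t = bracket (cd 2 f t) (A t) + S t"
    using assms(1) by (auto simp: lie_ode_def)
  have init: "norm (cd i f t0) \<le> r" if "i \<le> 2" for i
    using assms(2) that by (simp add: init_le_def)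
  have S: "norm (S t) \<le> r" if "t \<in> {t0..t1}" for t
    using derivs_leD[OF assms(3) _ that, of 0] by simp
  have r: "0 \<le> r"
    using assms(3) by (rule derivs_le_nonneg)
  have "derivs_to (cd 2 f) (\<lambda>t. bracket (cd 2 f t) (A t) + S t)"
    using ode by (intro derivs_to_cong[OF derivs_to_curve_deriv[OF f, of 2]])
      (simp_all add: numeral_2_eq_2 numeral_3_eq_3)
  note bound = norm_le_of_bracket_ode[OF this S]
  have b2: "norm (cd 2 f t) \<le> E ^ 1 * r" if "t \<in> {t0..t1}" for t
  proof -
    have "norm (cd 2 f t) \<le> norm (cd 2 f t0) + 2 * r * (t1 - t0)"
      using bound that by blast
    also have "2 * r * (t1 - t0) = (E - 1) * r"
      by (simp add: E_def)
    finally show ?thesis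
      using init[of 2] by (simp add: algebra_simps)
  qed
  have step: "norm (cd i f t) \<le> E ^ Suc k * r"
    if b: "\<And>t. t \<in> {t0..t1} \<Longrightarrow> norm (cd (Suc i) f t) \<le> E ^ k * r"
      and i: "i \<le> 2" and t: "t \<in> {t0..t1}" for i k t
  proof -
    have "norm (cd i f t) \<le> norm (cd i f t0) + E ^ k * r * (t1 - t0)"
      by (rule norm_le_of_deriv_le[OF derivs_to_curve_deriv[OF f] b t])
    also have "\<dots> \<le> E ^ k * r + E ^ k * r * (E - 1)"
    proof (rule add_mono)
      have "1 * r \<le> E ^ k * r"
        using E r by (intro mult_right_mono one_le_power)
      then show "norm (cd i f t0) \<le> E ^ k * r"
        using init[OF i] by linarith
      show "E ^ k * r * (t1 - t0) \<le> E ^ k * r * (E - 1)"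
        using E r E_eq t0_less_t1 by (intro mult_left_mono mult_nonneg_nonneg) auto
    qed
    finally show ?thesis
      by (simp add: algebra_simps)
  qed
  have b1: "norm (cd 1 f t) \<le> E ^ 2 * r" if "t \<in> {t0..t1}" for t
    using step[of 1 1 t, OF _ _ that] b2 by (simp add: numeral_2_eq_2)
  have b0: "norm (cd 0 f t) \<le> E ^ 3 * r" if "t \<in> {t0..t1}" for t
    using step[of 0 2 t, OF _ _ that] b1 by (simp add: numeral_2_eq_2 numeral_3_eq_3)
  have le: "E ^ k * r \<le> E ^ 3 * r" if "k \<le> 3" for k
    using E r that by (intro mult_right_mono power_increasing)
  have "norm (cd i f t) \<le> E ^ 3 * r" if "i \<le> 2" and t: "t \<in> {t0..t1}" for i t
  proof -
    consider "i = 0" | "i = 1" | "i = 2"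
      using \<open>i \<le> 2\<close> by linarith
    then show ?thesis
      using b0[OF t] order_trans[OF b1[OF t] le] order_trans[OF b2[OF t] le] by cases simp_all
  qed
  then show ?thesis
    unfolding E_def[symmetric] derivs_le_def by simp
qed

text \<open>Differentiating the equation j times expresses order j + 3 of \<open>f\<close> by order
  at most j + 2 of \<open>f\<close> and order at most j of \<open>A\<close> and
  \<open>S\<close>.\<close>

lemma lie_ode_derivs_le_step:
  assumes "lie_ode f A S" "derivs_le (j + 2) C f" "derivs_le j \<alpha> A" "derivs_le j r S"
  shows "derivs_le (j + 3) (C + 2 ^ j * (C * \<alpha>) + r) f"
proof -
  have sm: "smooth f" "smooth A" "smooth S" "smooth (cd 2 f)"
    using assms(1) by (auto simp: lie_ode_def smooth_curve_deriv)
  have nonneg: "0 \<le> C" "0 \<le> \<alpha>" "0 \<le> r"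
    using assms(2-4) by (auto dest: derivs_le_nonneg)
  let ?R = "\<lambda>t. bracket (cd 2 f t) (A t) + S t"
  have R: "derivs_le j (2 ^ j * (C * \<alpha>) + r) ?R"
    by (rule derivs_le_add[OF smooth_bracket _ derivs_le_bracket])
       (rule sm assms derivs_le_curve_deriv)+
  have top: "norm (cd (j + 3) f t) \<le> C + 2 ^ j * (C * \<alpha>) + r" if t: "t \<in> {t0..t1}" for t
  proof -
    have "cd (j + 3) f t = cd j (cd 3 f) t"
      by (simp only: curve_deriv_add)
    also have "\<dots> = cd j ?R t"
      by (rule curve_deriv_cong[OF _ t]) (use assms(1) in \<open>simp add: lie_ode_def\<close>)
    also have "norm \<dots> \<le> 2 ^ j * (C * \<alpha>) + r"
      by (rule derivs_leD[OF R le_refl t])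
    finally show ?thesis
      using nonneg(1) by linarith
  qed
  have "C \<le> C + 2 ^ j * (C * \<alpha>) + r"
    using nonneg by simp
  then have "derivs_le (j + 2) (C + 2 ^ j * (C * \<alpha>) + r) f"
    by (rule derivs_le_mono[OF assms(2) le_refl])
  moreover have "j + 3 = Suc (j + 2)"
    by simp
  ultimately show ?thesis
    using top by (simp only: derivs_le_Suc) blast
qed

lemma lie_ode_derivs_le:
  assumes "0 \<le> \<alpha>"
  obtains K where "0 \<le> K"
    "\<And>f A S r. lie_ode f A S \<Longrightarrow> init_le r f \<Longrightarrow> derivs_le j \<alpha> A \<Longrightarrow> derivs_le j r S
      \<Longrightarrow> derivs_le (j + 3) (K * r) f"
proof -
  \<comment> \<open>The order \<open>m\<close> reached is decoupled from the order \<open>j\<close>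
    assumed. Hypotheses of order j + 1 contain those of order j, and j + 3 is (j + 1) + 2, so each
    gain of one order is the next induction hypothesis.\<close>
  define H where "H j m K \<longleftrightarrow> 0 \<le> K \<and> (\<forall>f A S r. lie_ode f A S \<longrightarrow> init_le r f
    \<longrightarrow> derivs_le j \<alpha> A \<longrightarrow> derivs_le j r S \<longrightarrow> derivs_le m (K * r) f)" for j m :: nat and K
  have step: "H j (j + 3) (K + 2 ^ j * (K * \<alpha>) + 1)" if K: "H j (j + 2) K" for j K
    unfolding H_def
  proof (intro conjI allI impI)
    show "0 \<le> K + 2 ^ j * (K * \<alpha>) + 1"
      using K assms by (simp add: H_def)
    fix f A S r
    assume *: "lie_ode f A S" "init_le r f" "derivs_le j \<alpha> A" "derivs_le j r S"
    then have "derivs_le (j + 2) (K * r) f"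
      using K by (simp add: H_def)
    then have "derivs_le (j + 3) (K * r + 2 ^ j * (K * r * \<alpha>) + r) f"
      using * by (intro lie_ode_derivs_le_step)
    moreover have "K * r + 2 ^ j * (K * r * \<alpha>) + r = (K + 2 ^ j * (K * \<alpha>) + 1) * r"
      by (simp add: algebra_simps)
    ultimately show "derivs_le (j + 3) ((K + 2 ^ j * (K * \<alpha>) + 1) * r) f"
      by simp
  qed
  have "\<exists>K. H j (j + 2) K"
  proof (induction j)
    case 0
    show ?case
      using lie_ode_derivs_le_2 t0_less_t1 unfolding H_def
      by (intro exI[of _ "(1 + 2 * (t1 - t0)) ^ 3"] conjI allI impI) (simp_all flip: numeral_2_eq_2)
  next
    case (Suc j)
    then obtain K where "H j (j + 3) K"
      using step by blast
    then have "H (Suc j) (j + 3) K"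
      unfolding H_def derivs_le_Suc by blast
    then show ?case
      by (auto simp: eval_nat_numeral)
  qed
  then obtain K where "H j (j + 3) K"
    using step by blast
  then show thesis
    by (intro that[of K]) (simp_all add: H_def)
qed

end

section \<open>Asymptotic expansion of a variation\<close>

context time_interval
begin

text \<open>Differentiating the defining equation removes the constant, and the term [U', U']
  vanishes.\<close>

lemma lie_quadratic_ode:
  assumes "lie_quadratic t0 t1 U"
  shows "lie_ode U U (\<lambda>_. 0)"
proof -
  have U: "smooth U"
    using assms by (simp add: lie_quadratic_def)
  obtain C where C: "\<And>t. t \<in> {t0..t1} \<Longrightarrow> bracket (cd 1 U t) (U t) + C = cd 2 U t"
    using assms unfolding lie_quadratic_def by metis
  have "derivs_to (\<lambda>t. bracket (cd 1 U t) (U t) + C) (\<lambda>t. bracket (cd 2 U t) (U t))"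
  proof
    fix t assume t: "t \<in> {t0..t1}"
    have "((\<lambda>t. bracket (cd 1 U t) (U t) + C) has_vector_derivative
        (bracket (cd 1 U t) (cd 1 U t) + bracket (cd 2 U t) (U t)) + 0) (at t within {t0..t1})"
      using derivs_to_curve_deriv[OF U, of 0] derivs_to_curve_deriv[OF U, of 1] t
      by (intro has_vector_derivative_add bracket.has_vector_derivative has_vector_derivative_const)
         (auto simp: numeral_2_eq_2)
    then show "((\<lambda>t. bracket (cd 1 U t) (U t) + C) has_vector_derivative bracket (cd 2 U t) (U t))
        (at t within {t0..t1})"
      by simp
  qed
  then have "derivs_to (cd 2 U) (\<lambda>t. bracket (cd 2 U t) (U t))"
    by (rule derivs_to_cong) (simp_all only: C)
  then have "cd 3 U t = bracket (cd 2 U t) (U t)" if "t \<in> {t0..t1}" for t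
    using that curve_deriv_add[of 1 2 U] by (simp add: derivs_to_eq numeral_3_eq_3)
  then show ?thesis
    using U by (simp add: lie_ode_def smooth_const)
qed

lemma mixed_deriv_0: "mixed_deriv t0 t1 0 j V h t = cd j (V h) t"
proof -
  have "(partial_t t0 t1 ^^ j) V h t = cd j (V h) t"
  proof (induction j arbitrary: t)
    case (Suc j)
    then have "(partial_t t0 t1 ^^ j) V h = cd j (V h)"
      by blast
    then show ?case
      by (simp add: curve_deriv_Suc partial_t_def[of t0 t1 "(partial_t t0 t1 ^^ j) V"])
  qed simp
  then show ?thesis
    by (simp add: mixed_deriv_def)
qed

lemma affine_norm_le_1_slope:
  assumes "affine_norm_le_1 g"
  shows "h \<in> {-1..1} \<Longrightarrow> g h = g 0 + h *\<^sub>R (g 1 - g 0)" "norm (g 1 - g 0) \<le> 1"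
proof -
  obtain a b where g: "\<And>h. h \<in> {-1..1} \<Longrightarrow> g h = a + h *\<^sub>R b"
    and le: "\<And>h. h \<in> {-1..1} \<Longrightarrow> norm (g h) \<le> 1"
    using assms unfolding affine_norm_le_1_def by metis
  have b: "b = g 1 - g 0"
    by (simp add: g)
  show "h \<in> {-1..1} \<Longrightarrow> g h = g 0 + h *\<^sub>R (g 1 - g 0)"
    by (simp add: g)
  \<comment> \<open>Using both endpoints gives the slope bound 1; comparing 1 with 0 would only give
    2.\<close>
  have "2 *\<^sub>R b = g 1 - g (- 1)"
    by (simp add: g scaleR_2)
  also have "norm \<dots> \<le> 1 + 1"
    by (intro norm_triangle_le_diff add_mono le) simp_all
  finally show "norm (g 1 - g 0) \<le> 1"
    by (simp flip: b)
qed

section \<open>Initial data of a variation and bounds uniform over all variations\<close>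

abbreviation variation :: "(real \<Rightarrow> real \<Rightarrow> so3) \<Rightarrow> so3 \<Rightarrow> bool"
  where "variation \<equiv> lie_quadratic_variation t0 t1"

lemma variation_ode: "variation V D \<Longrightarrow> h \<in> {-1..1} \<Longrightarrow> lie_ode (V h) (V h) (\<lambda>_. 0)"
  unfolding lie_quadratic_variation_def by (intro lie_quadratic_ode) auto

lemma variation_0: "variation V D \<Longrightarrow> t \<in> {t0..t1} \<Longrightarrow> V 0 t = D"
  by (simp add: lie_quadratic_variation_def)

lemma variation_init:
  assumes "variation V D"
  obtains b where "\<And>j. j \<le> 2 \<Longrightarrow> norm (b j) \<le> 1"
    "\<And>j h. j \<le> 2 \<Longrightarrow> h \<in> {-1..1} \<Longrightarrow> cd j (V h) t0 = (if j = 0 then D else 0) + h *\<^sub>R b j"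
proof
  fix j :: nat and h :: real
  assume "j \<le> 2"
  then have aff: "affine_norm_le_1 (\<lambda>h. cd j (V h) t0)"
    using assms by (simp add: lie_quadratic_variation_def mixed_deriv_0)
  then show "norm (cd j (V 1) t0 - cd j (V 0) t0) \<le> 1"
    by (rule affine_norm_le_1_slope(2))
  have "cd j (V 0) t0 = (if j = 0 then D else 0)"
    using curve_deriv_cong[of "V 0" "\<lambda>_. D" t0 j] variation_0[OF assms] t0_less_t1
    by (simp add: curve_deriv_const)
  then show "cd j (V h) t0 = (if j = 0 then D else 0) + h *\<^sub>R (cd j (V 1) t0 - cd j (V 0) t0)"
    if "h \<in> {-1..1}"
    using affine_norm_le_1_slope(1)[OF aff that] by simp
qed

lemma variation_init_le: "variation V D \<Longrightarrow> h \<in> {-1..1} \<Longrightarrow> init_le 1 (V h)"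
  by (simp add: lie_quadratic_variation_def mixed_deriv_0 affine_norm_le_1_def init_le_def)

text \<open>Here coefficient and solution coincide, so the bound already found for order j is fed
  back as the bound on the coefficient. The start at order 0 is the estimate that does not involve
  the coefficient.\<close>

lemma variation_derivs_le:
  "\<exists>K\<ge>0. \<forall>V D. \<forall>h\<in>{-1..1}. variation V D \<longrightarrow> derivs_le j K (V h)"
proof (induction j)
  case 0
  have "derivs_le 0 ((1 + 2 * (t1 - t0)) ^ 3 * 1) (V h)" if "variation V D" "h \<in> {-1..1}" for V D h
    by (rule derivs_le_mono[OF lie_ode_derivs_le_2[OF variation_ode[OF that]
            variation_init_le[OF that] derivs_le_const]]) simp_all
  then show ?case
    using t0_less_t1 by (intro exI[of _ "(1 + 2 * (t1 - t0)) ^ 3 * 1"]) auto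
next
  case (Suc j)
  then obtain \<alpha> where \<alpha>: "\<alpha> \<ge> 0" and
    le: "\<And>V D h. h \<in> {-1..1} \<Longrightarrow> variation V D \<Longrightarrow> derivs_le j \<alpha> (V h)"
    by blast
  obtain K where K: "K \<ge> 0" and
    step: "\<And>f A S r. lie_ode f A S \<Longrightarrow> init_le r f \<Longrightarrow> derivs_le j \<alpha> A \<Longrightarrow> derivs_le j r S
      \<Longrightarrow> derivs_le (j + 3) (K * r) f"
    using lie_ode_derivs_le[OF \<alpha>] by metis
  have "derivs_le (Suc j) (K * 1) (V h)" if "variation V D" "h \<in> {-1..1}" for V D h
    by (rule derivs_le_lower[OF step[OF variation_ode[OF that] variation_init_le[OF that]
            le[OF that(2,1)] derivs_le_const]]) simp_all
  then show ?case
    using K by (intro exI[of _ K]) auto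
qed

text \<open>Taking h = 1 in the second clause shows that the initial data of \<open>W\<close> are
  the slopes in h of those of V.\<close>

definition first_order :: "(real \<Rightarrow> real \<Rightarrow> so3) \<Rightarrow> so3 \<Rightarrow> (real \<Rightarrow> so3) \<Rightarrow> bool"
  where "first_order V D W \<longleftrightarrow> lie_ode W (\<lambda>_. D) (\<lambda>_. 0) \<and>
    (\<forall>j\<le>2. \<forall>h\<in>{-1..1}. cd j (V h) t0 = (if j = 0 then D else 0) + h *\<^sub>R cd j W t0)"

text \<open>Z carries the weight h^2 / 2, whence the factor 2 in front of [W'', W]. Its initial data
  vanish because affine data have no quadratic part.\<close>

definition second_order :: "so3 \<Rightarrow> (real \<Rightarrow> so3) \<Rightarrow> (real \<Rightarrow> so3) \<Rightarrow> bool"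
  where "second_order D W Z \<longleftrightarrow> lie_ode Z (\<lambda>_. D) (\<lambda>t. 2 *\<^sub>R bracket (cd 2 W t) (W t)) \<and>
    (\<forall>j\<le>2. cd j Z t0 = 0)"

text \<open>This bounds the coefficient of both linearised equations by 1, uniformly over all
  variations.\<close>

lemma norm_D_le_1: "variation V D \<Longrightarrow> norm D \<le> 1"
  using variation_init_le[of V D 0] variation_0[of V D t0] t0_less_t1 by (auto simp: init_le_def)

lemma lie_odeD:
  assumes "lie_ode f A S"
  shows "smooth f" "smooth A" "smooth S"
    "t \<in> {t0..t1} \<Longrightarrow> cd 3 f t = bracket (cd 2 f t) (A t) + S t"
  using assms by (auto simp: lie_ode_def)

lemma variation_smooth: "variation V D \<Longrightarrow> h \<in> {-1..1} \<Longrightarrow> smooth (V h)"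
  using variation_ode lie_odeD(1) by blast

lemma first_order_derivs_le:
  "\<exists>K\<ge>0. \<forall>V D W. variation V D \<longrightarrow> first_order V D W \<longrightarrow> derivs_le j K W"
proof -
  obtain K where K: "K \<ge> 0" and
    step: "\<And>f A S r. lie_ode f A S \<Longrightarrow> init_le r f \<Longrightarrow> derivs_le j 1 A \<Longrightarrow> derivs_le j r S
      \<Longrightarrow> derivs_le (j + 3) (K * r) f"
    using lie_ode_derivs_le[OF zero_le_one] by metis
  have "derivs_le j (K * 1) W" if V: "variation V D" and W: "first_order V D W" for V D W
  proof -
    obtain b where b: "\<And>j. j \<le> 2 \<Longrightarrow> norm (b j) \<le> 1"
      "\<And>j h. j \<le> 2 \<Longrightarrow> h \<in> {-1..1} \<Longrightarrow> cd j (V h) t0 = (if j = 0 then D else 0) + h *\<^sub>R b j"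
      using variation_init[OF V] by metis
    have "cd j W t0 = b j" if "j \<le> 2" for j
      using b(2)[OF that, of 1] W that by (auto simp: first_order_def)
    then have init: "init_le 1 W"
      using b(1) by (simp add: init_le_def)
    have ode: "lie_ode W (\<lambda>_. D) (\<lambda>_. 0)"
      using W by (simp add: first_order_def)
    show ?thesis
      by (rule derivs_le_lower[OF step[OF ode init derivs_le_const derivs_le_const]])
         (simp_all add: norm_D_le_1[OF V])
  qed
  then show ?thesis
    using K by (intro exI[of _ K]) auto
qed

text \<open>Subtracting a constant leaves U''' = [U'', V_h] intact, with zero source, while the
  initial data shrink to h times slopes of norm at most 1.\<close>

lemma expansion_0:
  "\<exists>K\<ge>0. \<forall>V D. \<forall>h\<in>{-1..1}. variation V D \<longrightarrow> derivs_le j (K * \<bar>h\<bar>) (\<lambda>t. V h t - D)"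
proof -
  obtain \<alpha> where \<alpha>: "\<alpha> \<ge> 0" and
    le: "\<And>V D h. h \<in> {-1..1} \<Longrightarrow> variation V D \<Longrightarrow> derivs_le j \<alpha> (V h)"
    using variation_derivs_le by blast
  obtain K where K: "K \<ge> 0" and
    step: "\<And>f A S r. lie_ode f A S \<Longrightarrow> init_le r f \<Longrightarrow> derivs_le j \<alpha> A \<Longrightarrow> derivs_le j r S
      \<Longrightarrow> derivs_le (j + 3) (K * r) f"
    using lie_ode_derivs_le[OF \<alpha>] by metis
  have "derivs_le j (K * \<bar>h\<bar>) (\<lambda>t. V h t - D)" if V: "variation V D" and h: "h \<in> {-1..1}" for V D h
  proof -
    have sm: "smooth (V h)"
      using V h by (rule variation_smooth)
    have cd: "cd i (\<lambda>t. V h t - D) t = cd i (V h) t - (if i = 0 then D else 0)"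
      if "t \<in> {t0..t1}" for i t
      using that by (simp add: curve_deriv_diff sm smooth_const curve_deriv_const)
    have ode: "lie_ode (\<lambda>t. V h t - D) (V h) (\<lambda>_. 0)"
      using lie_odeD[OF variation_ode[OF V h]]
      by (auto simp: lie_ode_def cd smooth_diff smooth_const)
    obtain b where b: "\<And>j. j \<le> 2 \<Longrightarrow> norm (b j) \<le> 1"
      "\<And>j h. j \<le> 2 \<Longrightarrow> h \<in> {-1..1} \<Longrightarrow> cd j (V h) t0 = (if j = 0 then D else 0) + h *\<^sub>R b j"
      using variation_init[OF V] by metis
    have "norm (cd i (\<lambda>t. V h t - D) t0) \<le> \<bar>h\<bar>" if "i \<le> 2" for i
      using t0_less_t1 b(2)[OF that h] mult_left_le[OF b(1)[OF that] abs_ge_zero[of h]]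
      by (simp add: cd)
    then have init: "init_le \<bar>h\<bar> (\<lambda>t. V h t - D)"
      by (simp add: init_le_def)
    show ?thesis
      by (rule derivs_le_lower[OF step[OF ode init le[OF h V] derivs_le_const]]) simp_all
  qed
  then show ?thesis
    using K by auto
qed

text \<open>With P = V_h - D and P2 = P - h W, bilinearity gives P2''' = [P2'', D] + [P'', P]. The
  source is a product of two factors of size h; its second derivative is why P is bounded to order j
  + 2.\<close>

lemma expansion_1:
  "\<exists>K\<ge>0. \<forall>V D W. \<forall>h\<in>{-1..1}. variation V D \<longrightarrow> first_order V D W
    \<longrightarrow> derivs_le j (K * h\<^sup>2) (\<lambda>t. V h t - D - h *\<^sub>R W t)"
proof -
  obtain KP where KP: "KP \<ge> 0" and
    P_le: "\<And>V D h. h \<in> {-1..1} \<Longrightarrow> variation V D \<Longrightarrow> derivs_le (j + 2) (KP * \<bar>h\<bar>) (\<lambda>t. V h t - D)"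
    using expansion_0 by blast
  obtain K where K: "K \<ge> 0" and
    step: "\<And>f A S r. lie_ode f A S \<Longrightarrow> init_le r f \<Longrightarrow> derivs_le j 1 A \<Longrightarrow> derivs_le j r S
      \<Longrightarrow> derivs_le (j + 3) (K * r) f"
    using lie_ode_derivs_le[OF zero_le_one] by metis
  let ?K = "2 ^ j * (KP * KP)"
  have "derivs_le j (K * ?K * h\<^sup>2) (\<lambda>t. V h t - D - h *\<^sub>R W t)"
    if V: "variation V D" and h: "h \<in> {-1..1}" and W: "first_order V D W" for V D W h
  proof -
    define P where "P t = V h t - D" for t
    define P2 where "P2 t = V h t - D - h *\<^sub>R W t" for t
    have sm: "smooth (V h)" "smooth W"
      using variation_smooth[OF V h] W by (auto simp: first_order_def lie_ode_def)
    have smP: "smooth P" "smooth P2" "smooth (cd 2 P)"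
      unfolding P_def P2_def by (intro smooth_curve_deriv smooth_diff smooth_const smooth_scaleR sm)+
    have cdP: "cd i P t = cd i (V h) t - (if i = 0 then D else 0)" if "t \<in> {t0..t1}" for i t
      using that by (simp add: P_def[abs_def] curve_deriv_diff sm smooth_const curve_deriv_const)
    have cdP2: "cd i P2 t = cd i (V h) t - (if i = 0 then D else 0) - h *\<^sub>R cd i W t"
      if "t \<in> {t0..t1}" for i t
      using that sm by (simp add: P2_def[abs_def] curve_deriv_diff smooth_diff smooth_scaleR
          curve_deriv_scaleR smooth_const curve_deriv_const)
    have ode: "lie_ode P2 (\<lambda>_. D) (\<lambda>t. bracket (cd 2 P t) (P t))"
      unfolding lie_ode_def
    proof (intro conjI ballI)
      show "smooth (\<lambda>t. bracket (cd 2 P t) (P t))"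
        using smP by (intro smooth_bracket)
      fix t assume t: "t \<in> {t0..t1}"
      have "cd 3 P2 t = bracket (cd 2 (V h) t) (V h t) - h *\<^sub>R bracket (cd 2 W t) D"
        using lie_odeD(4)[OF variation_ode[OF V h] t] W t
        by (simp add: cdP2 first_order_def lie_ode_def)
      also have "\<dots> = bracket (cd 2 P2 t) D + bracket (cd 2 P t) (P t)"
        using t by (simp add: cdP cdP2 P_def bracket.diff_left bracket.diff_right bracket.scaleR_left)
      finally show "cd 3 P2 t = bracket (cd 2 P2 t) D + bracket (cd 2 P t) (P t)" .
    qed (use smP in \<open>auto simp: smooth_const\<close>)
    \<comment> \<open>The initial data are in fact zero; the bound is relaxed to the size of the
      source because the estimate takes one common \<open>r\<close>.\<close>
    have init: "init_le (?K * h\<^sup>2) P2"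
      using W h KP t0_less_t1 by (auto simp: init_le_def first_order_def cdP2)
    have "derivs_le j (2 ^ j * ((KP * \<bar>h\<bar>) * (KP * \<bar>h\<bar>))) (\<lambda>t. bracket (cd 2 P t) (P t))"
      using derivs_le_lower[OF P_le[OF h V], of j] P_le[OF h V] smP unfolding P_def[symmetric]
      by (intro derivs_le_bracket derivs_le_curve_deriv) auto
    moreover have "2 ^ j * ((KP * \<bar>h\<bar>) * (KP * \<bar>h\<bar>)) = ?K * h\<^sup>2"
      by (simp add: power2_eq_square)
    ultimately have S: "derivs_le j (?K * h\<^sup>2) (\<lambda>t. bracket (cd 2 P t) (P t))"
      by simp
    have "derivs_le j (K * (?K * h\<^sup>2)) P2"
      by (rule derivs_le_lower[OF step[OF ode init derivs_le_const S]])
         (simp_all add: norm_D_le_1[OF V])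
    then show ?thesis
      by (simp add: P2_def[abs_def] mult.assoc)
  qed
  then show ?thesis
    using K KP by (intro exI[of _ "K * ?K"]) auto
qed

text \<open>With P3 = P2 - (h^2 / 2) Z, the equation becomes P3''' = [P3'', D] + [P2'', P] + h
  [W'', P2]. Both source terms pair a factor of size h^2 with one of size h.\<close>

lemma expansion_2:
  "\<exists>K\<ge>0. \<forall>V D W Z. \<forall>h\<in>{-1..1}. variation V D \<longrightarrow> first_order V D W \<longrightarrow> second_order D W Z
    \<longrightarrow> derivs_le j (K * \<bar>h\<bar> ^ 3) (\<lambda>t. V h t - D - h *\<^sub>R W t - (h\<^sup>2 / 2) *\<^sub>R Z t)"
proof -
  obtain KP where KP: "KP \<ge> 0" and
    P_le: "\<And>V D h. h \<in> {-1..1} \<Longrightarrow> variation V D \<Longrightarrow> derivs_le (j + 2) (KP * \<bar>h\<bar>) (\<lambda>t. V h t - D)"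
    using expansion_0 by blast
  obtain KQ where KQ: "KQ \<ge> 0" and
    Q_le: "\<And>V D W h. h \<in> {-1..1} \<Longrightarrow> variation V D \<Longrightarrow> first_order V D W
      \<Longrightarrow> derivs_le (j + 2) (KQ * h\<^sup>2) (\<lambda>t. V h t - D - h *\<^sub>R W t)"
    using expansion_1 by blast
  obtain KW where KW: "KW \<ge> 0" and
    W_le: "\<And>V D W. variation V D \<Longrightarrow> first_order V D W \<Longrightarrow> derivs_le (j + 2) KW W"
    using first_order_derivs_le by blast
  obtain K where K: "K \<ge> 0" and
    step: "\<And>f A S r. lie_ode f A S \<Longrightarrow> init_le r f \<Longrightarrow> derivs_le j 1 A \<Longrightarrow> derivs_le j r S
      \<Longrightarrow> derivs_le (j + 3) (K * r) f"
    using lie_ode_derivs_le[OF zero_le_one] by metis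
  let ?K = "2 ^ j * (KQ * KP + KW * KQ)"
  have "derivs_le j (K * ?K * \<bar>h\<bar> ^ 3) (\<lambda>t. V h t - D - h *\<^sub>R W t - (h\<^sup>2 / 2) *\<^sub>R Z t)"
    if V: "variation V D" and h: "h \<in> {-1..1}" and W: "first_order V D W" and Z: "second_order D W Z"
    for V D W Z h
  proof -
    define P where "P t = V h t - D" for t
    define P2 where "P2 t = V h t - D - h *\<^sub>R W t" for t
    define P3 where "P3 t = V h t - D - h *\<^sub>R W t - (h\<^sup>2 / 2) *\<^sub>R Z t" for t
    let ?S1 = "\<lambda>t. bracket (cd 2 P2 t) (P t)" and ?S2 = "\<lambda>t. bracket (cd 2 W t) (P2 t)"
    have sm: "smooth (V h)" "smooth W" "smooth Z"
      using variation_smooth[OF V h] W Z by (auto simp: first_order_def second_order_def lie_ode_def)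
    have smP: "smooth P" "smooth P2" "smooth P3" "smooth (cd 2 P2)" "smooth (cd 2 W)"
      unfolding P_def P2_def P3_def
      by (intro smooth_curve_deriv smooth_diff smooth_const smooth_scaleR sm)+
    have smS: "smooth ?S1" "smooth ?S2"
      using smP by (simp_all add: smooth_bracket)
    have cdP2: "cd i P2 t = cd i (V h) t - (if i = 0 then D else 0) - h *\<^sub>R cd i W t"
      if "t \<in> {t0..t1}" for i t
      using that sm by (simp add: P2_def[abs_def] curve_deriv_diff smooth_diff smooth_scaleR
          curve_deriv_scaleR smooth_const curve_deriv_const)
    have cdP3: "cd i P3 t =
        cd i (V h) t - (if i = 0 then D else 0) - h *\<^sub>R cd i W t - (h\<^sup>2 / 2) *\<^sub>R cd i Z t"
      if "t \<in> {t0..t1}" for i t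
      using that sm by (simp add: P3_def[abs_def] curve_deriv_diff smooth_diff smooth_scaleR
          curve_deriv_scaleR smooth_const curve_deriv_const)
    have ode: "lie_ode P3 (\<lambda>_. D) (\<lambda>t. ?S1 t + h *\<^sub>R ?S2 t)"
      unfolding lie_ode_def
    proof (intro conjI ballI)
      show "smooth (\<lambda>t. ?S1 t + h *\<^sub>R ?S2 t)"
        using smS by (intro smooth_add smooth_scaleR)
      fix t assume t: "t \<in> {t0..t1}"
      have "cd 3 P3 t = bracket (cd 2 (V h) t) (V h t) - h *\<^sub>R bracket (cd 2 W t) D
          - (h\<^sup>2 / 2) *\<^sub>R (bracket (cd 2 Z t) D + 2 *\<^sub>R bracket (cd 2 W t) (W t))"
        using lie_odeD(4)[OF variation_ode[OF V h] t] W Z t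
        by (simp add: cdP3 first_order_def second_order_def lie_ode_def)
      also have "\<dots> = bracket (cd 2 P3 t) D + (?S1 t + h *\<^sub>R ?S2 t)"
        using t by (simp add: cdP3 cdP2 P_def P2_def bracket.diff_left bracket.diff_right
            bracket.scaleR_left bracket.scaleR_right scaleR_add_right scaleR_diff_right
            power2_eq_square)
      finally show "cd 3 P3 t = bracket (cd 2 P3 t) D + (?S1 t + h *\<^sub>R ?S2 t)" .
    qed (use smP in \<open>auto simp: smooth_const\<close>)
    have init: "init_le (?K * \<bar>h\<bar> ^ 3) P3"
      using W Z h KP KQ KW t0_less_t1
      by (auto simp: init_le_def first_order_def second_order_def cdP3)
    have leP: "derivs_le (j + 2) (KP * \<bar>h\<bar>) P"
      unfolding P_def by (rule P_le[OF h V])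
    have leP2: "derivs_le (j + 2) (KQ * h\<^sup>2) P2"
      unfolding P2_def by (rule Q_le[OF h V W])
    have "derivs_le j (2 ^ j * ((KQ * h\<^sup>2) * (KP * \<bar>h\<bar>))
        + \<bar>h\<bar> * (2 ^ j * (KW * (KQ * h\<^sup>2)))) (\<lambda>t. ?S1 t + h *\<^sub>R ?S2 t)"
      using derivs_le_lower[OF leP, of j] derivs_le_lower[OF leP2, of j] leP2 W_le[OF V W] smP smS
      by (intro derivs_le_add derivs_le_scaleR smooth_scaleR derivs_le_bracket derivs_le_curve_deriv)
         auto
    \<comment> \<open>The identity is polynomial in one variable; it is applied to the absolute
      value of h, whose square is h^2.\<close>
    moreover have "2 ^ j * ((KQ * a\<^sup>2) * (KP * a)) + a * (2 ^ j * (KW * (KQ * a\<^sup>2))) = ?K * a ^ 3" for a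
      by (simp add: power3_eq_cube power2_eq_square algebra_simps)
    from this[of "\<bar>h\<bar>"]
    have "2 ^ j * ((KQ * h\<^sup>2) * (KP * \<bar>h\<bar>)) + \<bar>h\<bar> * (2 ^ j * (KW * (KQ * h\<^sup>2)))
        = ?K * \<bar>h\<bar> ^ 3"
      by (simp only: power2_abs)
    ultimately have S: "derivs_le j (?K * \<bar>h\<bar> ^ 3) (\<lambda>t. ?S1 t + h *\<^sub>R ?S2 t)"
      by simp
    have "derivs_le j (K * (?K * \<bar>h\<bar> ^ 3)) P3"
      by (rule derivs_le_lower[OF step[OF ode init derivs_le_const S]])
         (simp_all add: norm_D_le_1[OF V])
    then show ?thesis
      by (simp add: P3_def[abs_def] mult.assoc)
  qed
  then show ?thesis
    using K KP KQ KW by (intro exI[of _ "K * ?K"]) auto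
qed

end

section \<open>Derivatives in the variation parameter\<close>

lemma has_vector_derivative_of_quadratic_remainder:
  fixes g :: "real \<Rightarrow> 'a::real_normed_vector"
  assumes K: "0 \<le> K" and le: "\<And>h. h \<in> {-1..1} \<Longrightarrow> norm (g h - a - h *\<^sub>R b) \<le> K * h\<^sup>2"
  shows "(g has_vector_derivative b) (at 0 within {-1..1})"
  unfolding has_vector_derivative_def has_derivative_within_alt
proof (intro conjI allI impI)
  have g0: "g 0 = a"
    using le[of 0] by simp
  fix e :: real assume e: "0 < e"
  \<comment> \<open>The radius \<open>e / (K + 1)\<close> also makes sense for K = 0, and it makes K
    times the absolute value of h at most e.\<close>
  have "norm (g h - g 0 - (h - 0) *\<^sub>R b) \<le> e * norm (h - 0)"
    if h: "h \<in> {-1..1}" "norm (h - 0) < e / (K + 1)" for h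
  proof -
    have "(K + 1) * \<bar>h\<bar> < e"
      using h(2) K by (simp add: field_simps)
    then have "K * \<bar>h\<bar> \<le> e"
      using K by (simp add: algebra_simps)
    then have "K * \<bar>h\<bar> * \<bar>h\<bar> \<le> e * \<bar>h\<bar>"
      by (rule mult_right_mono) simp
    then have "K * h\<^sup>2 \<le> e * \<bar>h\<bar>"
      by (simp add: power2_eq_square mult.assoc)
    then show ?thesis
      using le[OF h(1)] by (simp add: g0)
  qed
  then show "\<exists>d>0. \<forall>h\<in>{-1..1}. norm (h - 0) < d \<longrightarrow> norm (g h - g 0 - (h - 0) *\<^sub>R b) \<le> e * norm (h - 0)"
    using e K by (intro exI[of _ "e / (K + 1)"]) simp
qed (simp add: bounded_linear_scaleR_left)

text \<open>Peano's form of Taylor's theorem: integrating g'(h) - b - h c' = o(h) gives a quadratic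
  expansion with error o(h^2), and two such expansions with the same constant and linear terms
  agree. The cubic bound alone would not make g twice differentiable.\<close>

lemma second_derivative_of_cubic_remainder:
  fixes g g' :: "real \<Rightarrow> 'a::real_normed_vector"
  assumes g: "\<And>h. h \<in> {-1..1} \<Longrightarrow> (g has_vector_derivative g' h) (at h within {-1..1})"
    and g': "(g' has_vector_derivative c') (at 0 within {-1..1})" "g' 0 = b"
    and K: "0 \<le> K"
    and le: "\<And>h. h \<in> {-1..1} \<Longrightarrow> norm (g h - a - h *\<^sub>R b - (h\<^sup>2 / 2) *\<^sub>R c) \<le> K * \<bar>h\<bar> ^ 3"
  shows "c' = c"
proof -
  have g0: "g 0 = a"
    using le[of 0] by simp
  have "norm (c' - c) \<le> 0 + e" if e: "0 < e" for e
  proof -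
    obtain d where d: "0 < d" and
      g'_le: "\<And>h. h \<in> {-1..1} \<Longrightarrow> norm h < d \<Longrightarrow> norm (g' h - b - h *\<^sub>R c') \<le> e / 4 * norm h"
      using g'(1) e unfolding has_vector_derivative_def has_derivative_within_alt g'(2)
      by (auto dest!: spec[of _ "e / 4"])
    \<comment> \<open>Such an h lies in the range where g' is controlled; with m =
      \<open>e / 4 / (K + 1)\<close> the cubic error is also at most (e / 4) h^2. Two errors of this
      size balance the factor h^2 / 2 in front of c' - c.\<close>
    have "\<exists>h. 0 < h \<and> h \<le> 1 \<and> h < d \<and> h \<le> m" if "0 < m" for m
      using d that by (intro exI[of _ "min (1 / 2) (min (d / 2) m)"]) auto
    moreover have "0 < e / 4 / (K + 1)"
      using e K by simp
    ultimately obtain h where h: "0 < h" "h \<le> 1" "h < d" "h \<le> e / 4 / (K + 1)"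
      by blast
    have "norm ((g h - a - h *\<^sub>R b - (h\<^sup>2 / 2) *\<^sub>R c') - (g 0 - a - 0 *\<^sub>R b - (0\<^sup>2 / 2) *\<^sub>R c'))
        \<le> (e / 4 * h) * norm (h - 0)"
    proof (rule differentiable_bound[of "{0..h}"])
      fix s assume s: "s \<in> {0..h}"
      have "(g has_vector_derivative g' s) (at s within {0..h})"
        using s h by (intro has_vector_derivative_within_subset[OF g]) auto
      then have "((\<lambda>s. g s - a - s *\<^sub>R b - (s\<^sup>2 / 2) *\<^sub>R c') has_vector_derivative
          g' s - b - s *\<^sub>R c') (at s within {0..h})"
        by (auto intro!: derivative_eq_intros)
      then show "((\<lambda>s. g s - a - s *\<^sub>R b - (s\<^sup>2 / 2) *\<^sub>R c') has_derivative
          (\<lambda>x. x *\<^sub>R (g' s - b - s *\<^sub>R c'))) (at s within {0..h})"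
        by (simp add: has_vector_derivative_def)
      have "norm (g' s - b - s *\<^sub>R c') \<le> e / 4 * norm s"
        using s h by (intro g'_le) auto
      also have "\<dots> \<le> e / 4 * h"
        using s e by (intro mult_left_mono) auto
      finally show "onorm (\<lambda>x. x *\<^sub>R (g' s - b - s *\<^sub>R c')) \<le> e / 4 * h"
        by (intro onorm_le) (simp add: mult_left_mono mult.commute[of "e / 4 * h"] del: times_divide_eq_left)
    qed (use h in auto)
    then have "norm (g h - a - h *\<^sub>R b - (h\<^sup>2 / 2) *\<^sub>R c') \<le> e / 4 * h\<^sup>2"
      using h(1) by (simp add: g0 power2_eq_square)
    moreover have "norm (g h - a - h *\<^sub>R b - (h\<^sup>2 / 2) *\<^sub>R c) \<le> e / 4 * h\<^sup>2"
    proof -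
      have "K * h \<le> (K + 1) * (e / 4 / (K + 1))"
        using h(1,4) K by (intro mult_mono) simp_all
      also have "\<dots> = e / 4"
        using K by (intro nonzero_mult_div_cancel_left[of "K + 1", unfolded times_divide_eq_right[symmetric]]) simp
      finally have Kh: "K * h * h\<^sup>2 \<le> e / 4 * h\<^sup>2"
        by (rule mult_right_mono) simp
      have "norm (g h - a - h *\<^sub>R b - (h\<^sup>2 / 2) *\<^sub>R c) \<le> K * \<bar>h\<bar> ^ 3"
        using h by (intro le) simp
      also have "\<dots> = K * h * h\<^sup>2"
        using h(1) by (simp add: power3_eq_cube power2_eq_square)
      finally show ?thesis
        using Kh by (rule order_trans)
    qed
    ultimately have "norm ((g h - a - h *\<^sub>R b - (h\<^sup>2 / 2) *\<^sub>R c) -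
        (g h - a - h *\<^sub>R b - (h\<^sup>2 / 2) *\<^sub>R c')) \<le> e / 4 * h\<^sup>2 + e / 4 * h\<^sup>2"
      by (intro norm_triangle_le_diff) simp
    also have "(g h - a - h *\<^sub>R b - (h\<^sup>2 / 2) *\<^sub>R c) - (g h - a - h *\<^sub>R b - (h\<^sup>2 / 2) *\<^sub>R c')
        = (h\<^sup>2 / 2) *\<^sub>R (c' - c)"
      by (simp add: scaleR_diff_right)
    finally have "h\<^sup>2 / 2 * norm (c' - c) \<le> h\<^sup>2 / 2 * e"
      by (simp add: mult.commute[of e])
    then show ?thesis
      using h(1) by simp
  qed
  then have "norm (c' - c) \<le> 0"
    by (rule field_le_epsilon)
  then show ?thesis
    by simp
qed

context time_interval
begin

lemma vector_derivative_h:
  assumes "(f has_vector_derivative f') (at h within {-1..1})" "h \<in> {-1..1}"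
  shows "vector_derivative f (at h within {-1..1::real}) = f'"
  using vector_derivative_within_cbox[of "-1" 1 h f f'] assms by simp

lemma first_order_unique:
  assumes V: "variation V D" and W: "first_order V D W" and t: "t \<in> {t0..t1}"
  shows "mixed_deriv t0 t1 1 0 V 0 t = W t"
proof -
  obtain K where K: "0 \<le> K"
    and le: "\<And>h. h \<in> {-1..1} \<Longrightarrow> derivs_le 0 (K * h\<^sup>2) (\<lambda>t. V h t - D - h *\<^sub>R W t)"
    using expansion_1[of 0] V W by blast
  have "((\<lambda>h. V h t) has_vector_derivative W t) (at 0 within {-1..1})"
    using derivs_leD[OF le le_refl t]
    by (intro has_vector_derivative_of_quadratic_remainder[OF K]) simp
  then show ?thesis
    by (simp add: mixed_deriv_def partial_h_def vector_derivative_h)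
qed

text \<open>The smoothness of \<open>V\<close> supplies the second derivative in h; the cubic
  expansion only identifies its value.\<close>

lemma second_order_unique:
  assumes V: "variation V D" and W: "first_order V D W" and Z: "second_order D W Z"
    and t: "t \<in> {t0..t1}"
  shows "mixed_deriv t0 t1 2 0 V 0 t = Z t"
proof -
  obtain K where K: "0 \<le> K"
    and le: "\<And>h. h \<in> {-1..1}
      \<Longrightarrow> derivs_le 0 (K * \<bar>h\<bar> ^ 3) (\<lambda>t. V h t - D - h *\<^sub>R W t - (h\<^sup>2 / 2) *\<^sub>R Z t)"
    using expansion_2[of 0] V W Z by blast
  have "C_class t0 t1 (Suc (Suc 0)) V"
    using V unfolding lie_quadratic_variation_def smooth_variation_def by blast
  then have diff: "(\<lambda>h. V h t) differentiable (at h within {-1..1})"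
    "(\<lambda>h. partial_h V h t) differentiable (at h within {-1..1})" if "h \<in> {-1..1}" for h
    using t that by auto
  have "partial_h (partial_h V) 0 t = Z t"
  proof (rule second_derivative_of_cubic_remainder[of "\<lambda>h. V h t" "\<lambda>h. partial_h V h t"])
    show "((\<lambda>h. V h t) has_vector_derivative partial_h V h t) (at h within {-1..1})"
      if "h \<in> {-1..1}" for h
      using diff(1)[OF that] by (simp add: partial_h_def vector_derivative_works)
    show "((\<lambda>h. partial_h V h t) has_vector_derivative partial_h (partial_h V) 0 t) (at 0 within {-1..1})"
      using diff(2)[of 0] by (simp add: partial_h_def[of "partial_h V"] vector_derivative_works)
    show "partial_h V 0 t = W t"
      using first_order_unique[OF V W t] by (simp add: mixed_deriv_def)
    show "norm (V h t - D - h *\<^sub>R W t - (h\<^sup>2 / 2) *\<^sub>R Z t) \<le> K * \<bar>h\<bar> ^ 3" if "h \<in> {-1..1}" for h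
      using derivs_leD[OF le[OF that] le_refl t] by simp
  qed (rule K)
  then show ?thesis
    by (simp add: mixed_deriv_def numeral_2_eq_2)
qed

end


section \<open>Rodrigues' formula\<close>

lemma blinfun_exp_Rodrigues:
  fixes J :: "'a::real_normed_vector \<Rightarrow>\<^sub>L 'a"
  assumes J: "J o\<^sub>L (J o\<^sub>L J) = - J"
  shows "blinfun_exp (x *\<^sub>R J) = id_blinfun + sin x *\<^sub>R J + (1 - cos x) *\<^sub>R (J o\<^sub>L J)"
proof -
  have compose: "J o\<^sub>L (A + B) = (J o\<^sub>L A) + (J o\<^sub>L B)" "J o\<^sub>L (A - B) = (J o\<^sub>L A) - (J o\<^sub>L B)"
    "J o\<^sub>L (r *\<^sub>R A) = r *\<^sub>R (J o\<^sub>L A)" "(r *\<^sub>R J) o\<^sub>L A = r *\<^sub>R (J o\<^sub>L A)"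
    "J o\<^sub>L id_blinfun = J" "J o\<^sub>L 0 = 0" for A B r
    by (auto intro!: blinfun_eqI simp: blinfun.bilinear_simps)
  \<comment> \<open>Since J^3 = - J, positive powers are signed copies of J and J^2, which is the
    pattern of the sine and cosine coefficients. The exception is n = 0: the pattern yields - J^2
    instead of the identity, and the last summand corrects this.\<close>
  have pow: "((\<lambda>S. (x *\<^sub>R J) o\<^sub>L S) ^^ n) id_blinfun = (fact n * sin_coeff n * x ^ n) *\<^sub>R J
      - (fact n * cos_coeff n * x ^ n) *\<^sub>R (J o\<^sub>L J) + (if n = 0 then id_blinfun + (J o\<^sub>L J) else 0)" for n
  proof (induction n)
    case (Suc n)
    then show ?case
      by (simp add: compose J sin_coeff_Suc cos_coeff_Suc del: of_nat_Suc) (simp add: algebra_simps)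
  qed simp
  have "(\<lambda>n. (sin_coeff n *\<^sub>R x ^ n) *\<^sub>R J - (cos_coeff n *\<^sub>R x ^ n) *\<^sub>R (J o\<^sub>L J)
      + (if n = 0 then id_blinfun + (J o\<^sub>L J) else 0))
    sums (sin x *\<^sub>R J - cos x *\<^sub>R (J o\<^sub>L J) + (id_blinfun + (J o\<^sub>L J)))"
    by (intro sums_add sums_diff sums_scaleR_left sin_converges cos_converges sums_single)
  moreover have "(1 / fact n) *\<^sub>R ((\<lambda>S. (x *\<^sub>R J) o\<^sub>L S) ^^ n) id_blinfun =
      (sin_coeff n *\<^sub>R x ^ n) *\<^sub>R J - (cos_coeff n *\<^sub>R x ^ n) *\<^sub>R (J o\<^sub>L J)
      + (if n = 0 then id_blinfun + (J o\<^sub>L J) else 0)" for n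
    unfolding pow by (simp add: scaleR_add_right scaleR_diff_right)
  ultimately have "(\<lambda>n. (1 / fact n) *\<^sub>R ((\<lambda>S. (x *\<^sub>R J) o\<^sub>L S) ^^ n) id_blinfun)
    sums (sin x *\<^sub>R J - cos x *\<^sub>R (J o\<^sub>L J) + (id_blinfun + (J o\<^sub>L J)))"
    by (simp only:)
  then have "blinfun_exp (x *\<^sub>R J) = sin x *\<^sub>R J - cos x *\<^sub>R (J o\<^sub>L J) + (id_blinfun + (J o\<^sub>L J))"
    unfolding blinfun_exp_def by (rule sums_unique[symmetric])
  then show ?thesis
    by (simp add: algebra_simps)
qed

section \<open>The closed form of the second variation\<close>

locale constant_quadratic = time_interval +
  fixes D :: so3
  assumes D_nonzero: "D \<noteq> 0"
begin

abbreviation d :: real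
  where "d \<equiv> norm D"

abbreviation F :: so3
  where "F \<equiv> F0 D"

abbreviation i :: "so3 \<Rightarrow> so3"
  where "i \<equiv> blinfun_apply (i_til D)"

abbreviation e :: "so3 \<Rightarrow> real \<Rightarrow> so3"
  where "e X t \<equiv> blinfun_apply (e_til D t0 t) X"

section \<open>Linear algebra of the operators \<open>i\<close> and \<open>e\<close>\<close>

lemma d_pos: "0 < d"
  using D_nonzero by simp

lemma i_eq: "i X = bracket F X"
  by (simp add: i_til_def ad_op.rep_eq)

lemma D_eq: "D = d *\<^sub>R F"
  using D_nonzero by (simp add: F0_def)

lemma inner_F_F [simp]: "inner F F = 1"
  using D_nonzero by (simp add: F0_def power2_eq_square flip: power2_norm_eq_inner)

text \<open>The homogeneous equation G' = [G, D] thus reads G' = - d i G, whose solution operator is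
  \<open>e\<close>.\<close>

lemma bracket_D: "bracket X D = - (d *\<^sub>R i X)"
  unfolding i_eq bracket_skew[of X] by (subst D_eq) (simp add: bracket.scaleR_left)

lemma i_F [simp]: "i F = 0"
  by (simp add: i_eq)

lemma i_i: "i (i X) = inner F X *\<^sub>R F - X"
  by (simp add: i_eq bracket_bracket)

lemma i_i_perp: "X \<in> F0_perp D \<Longrightarrow> i (i X) = - X"
  by (simp add: i_i F0_perp_def inner_commute)

text \<open>Expanding the triple product shows that the bracket commutes with F; hence it is its own
  component along the unit vector F. This turns the inner product in \<open>f2\<close> back into a
  bracket.\<close>

lemma bracket_perp:
  assumes "X \<in> F0_perp D" "Y \<in> F0_perp D"
  shows "inner (bracket X Y) F *\<^sub>R F = bracket X Y"
proof -
  have "i (bracket X Y) = 0"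
    using assms by (simp add: i_eq bracket_bracket F0_perp_def inner_commute)
  then show ?thesis
    using i_i[of "bracket X Y"] by (simp add: inner_commute)
qed

lemma e_til_eq: "e_til D t0 t = id_blinfun - sin (d * (t - t0)) *\<^sub>R i_til D
    + (1 - cos (d * (t - t0))) *\<^sub>R (i_til D o\<^sub>L i_til D)"
proof -
  have "i_til D o\<^sub>L (i_til D o\<^sub>L i_til D) = - i_til D"
    by (rule blinfun_eqI) (simp add: i_i blinfun.bilinear_simps)
  from blinfun_exp_Rodrigues[OF this, of "- (d * (t - t0))"] show ?thesis
    by (simp add: e_til_def)
qed

text \<open>On the plane orthogonal to F, where \<open>i\<close> is a quarter turn, \<open>e\<close>
  is the rotation by the angle - d (t - t0).\<close>

lemma e_perp: "X \<in> F0_perp D \<Longrightarrow> e X t = cos (d * (t - t0)) *\<^sub>R X - sin (d * (t - t0)) *\<^sub>R i X"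
  by (simp add: e_til_eq blinfun.bilinear_simps i_i_perp algebra_simps)

lemma i_perp: "i X \<in> F0_perp D"
  by (simp add: i_eq F0_perp_def)

lemma scaleR_perp: "X \<in> F0_perp D \<Longrightarrow> c *\<^sub>R X \<in> F0_perp D"
  by (simp add: F0_perp_def)

lemma diff_perp: "X \<in> F0_perp D \<Longrightarrow> Y \<in> F0_perp D \<Longrightarrow> X - Y \<in> F0_perp D"
  by (simp add: F0_perp_def inner_diff_left)

lemma add_perp: "X \<in> F0_perp D \<Longrightarrow> Y \<in> F0_perp D \<Longrightarrow> X + Y \<in> F0_perp D"
  by (simp add: F0_perp_def inner_add_left)

lemma perp_part: "X - inner X F *\<^sub>R F \<in> F0_perp D"
  by (simp add: F0_perp_def inner_diff_left)

lemma e_in_perp: "X \<in> F0_perp D \<Longrightarrow> e X t \<in> F0_perp D"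
  by (simp add: e_perp diff_perp scaleR_perp i_perp)

lemma i_e_perp: "X \<in> F0_perp D \<Longrightarrow> i (e X t) = cos (d * (t - t0)) *\<^sub>R i X + sin (d * (t - t0)) *\<^sub>R X"
  by (simp add: e_perp blinfun.bilinear_simps i_i_perp)

lemma e_t0: "X \<in> F0_perp D \<Longrightarrow> e X t0 = X"
  by (simp add: e_perp)

text \<open>All operators of the closed form are linear combinations of \<open>1\<close>, \<open>i\<close>, \<open>e\<close> and \<open>i e\<close> with
  polynomial coefficients.\<close>

definition comb ::
    "(real \<Rightarrow> real) \<Rightarrow> (real \<Rightarrow> real) \<Rightarrow> (real \<Rightarrow> real) \<Rightarrow> (real \<Rightarrow> real) \<Rightarrow> so3 \<Rightarrow> real \<Rightarrow> so3"
  where "comb a b c k X t = a t *\<^sub>R X + b t *\<^sub>R i X + c t *\<^sub>R e X t + k t *\<^sub>R i (e X t)"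

text \<open>The cross terms come from e' = - d i e and (i e)' = d e on \<open>F0_perp D\<close>. The
  functions \<open>c''\<close> and \<open>k''\<close> are the coefficients after differentiation,
  not second derivatives.\<close>

lemma derivs_to_comb:
  assumes X: "X \<in> F0_perp D"
    and "\<And>t. (a has_real_derivative a' t) (at t)" "\<And>t. (b has_real_derivative b' t) (at t)"
      "\<And>t. (c has_real_derivative c' t) (at t)" "\<And>t. (k has_real_derivative k' t) (at t)"
    and "\<And>t. c'' t = c' t + d * k t" "\<And>t. k'' t = k' t - d * c t"
  shows "derivs_to (comb a b c k X) (comb a' b' c'' k'' X)"
proof
  fix t
  have [derivative_intros]:
    "(a has_real_derivative a' t) (at t within {t0..t1})"
    "(b has_real_derivative b' t) (at t within {t0..t1})"
    "(c has_real_derivative c' t) (at t within {t0..t1})"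
    "(k has_real_derivative k' t) (at t within {t0..t1})"
    using assms(2-5) by (auto intro: has_field_derivative_at_within)
  have "((\<lambda>t. a t *\<^sub>R X + b t *\<^sub>R i X
      + c t *\<^sub>R (cos (d * (t - t0)) *\<^sub>R X - sin (d * (t - t0)) *\<^sub>R i X)
      + k t *\<^sub>R (cos (d * (t - t0)) *\<^sub>R i X + sin (d * (t - t0)) *\<^sub>R X)) has_vector_derivative
      a' t *\<^sub>R X + b' t *\<^sub>R i X
      + (c' t *\<^sub>R (cos (d * (t - t0)) *\<^sub>R X - sin (d * (t - t0)) *\<^sub>R i X)
         + c t *\<^sub>R ((- sin (d * (t - t0)) * d) *\<^sub>R X - (cos (d * (t - t0)) * d) *\<^sub>R i X))
      + (k' t *\<^sub>R (cos (d * (t - t0)) *\<^sub>R i X + sin (d * (t - t0)) *\<^sub>R X)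
         + k t *\<^sub>R ((- sin (d * (t - t0)) * d) *\<^sub>R i X + (cos (d * (t - t0)) * d) *\<^sub>R X)))
      (at t within {t0..t1})"
    by (auto intro!: derivative_eq_intros)
  then show "(comb a b c k X has_vector_derivative comb a' b' c'' k'' X t) (at t within {t0..t1})"
    unfolding comb_def[abs_def] assms(6,7)
    by (simp add: e_perp[OF X] i_e_perp[OF X] algebra_simps blinfun.bilinear_simps i_i_perp[OF X])
qed

lemma comb_t0: "X \<in> F0_perp D \<Longrightarrow> comb a b c k X t0 = (a t0 + c t0) *\<^sub>R X + (b t0 + k t0) *\<^sub>R i X"
  by (simp add: comb_def e_t0 algebra_simps)

lemma comb_perp: "X \<in> F0_perp D \<Longrightarrow> comb a b c k X t \<in> F0_perp D"
  by (simp add: comb_def add_perp scaleR_perp i_perp e_in_perp)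

text \<open>Smoothness is produced by the equation: as D is constant, differentiating gives J_(n+1)
  = [J_n, D] + S^(n), so \<open>p2\<close> generates all higher derivatives.\<close>

lemma lie_odeI:
  assumes "derivs_to f p1" "derivs_to p1 p2" "derivs_to p2 (\<lambda>t. bracket (p2 t) D + S t)" "smooth S"
  shows "lie_ode f (\<lambda>_. D) S"
    and "t \<in> {t0..t1} \<Longrightarrow> cd 1 f t = p1 t" "t \<in> {t0..t1} \<Longrightarrow> cd 2 f t = p2 t"
proof -
  define J where "J = rec_nat p2 (\<lambda>n g t. bracket (g t) D + cd n S t)"
  define G where "G n = (case n of 0 \<Rightarrow> f | Suc 0 \<Rightarrow> p1 | Suc (Suc n) \<Rightarrow> J n)" for n
  have J_simps: "J 0 = p2" "J (Suc n) = (\<lambda>t. bracket (J n t) D + cd n S t)" for n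
    by (simp_all add: J_def)
  have J: "derivs_to (J n) (J (Suc n))" for n
  proof (induction n)
    case 0
    then show ?case
      using assms(3) by (simp add: J_simps)
  next
    case (Suc n)
    have "derivs_to (\<lambda>t. bracket (J n t) D + cd n S t) (\<lambda>t. bracket (J (Suc n) t) D + cd (Suc n) S t)"
    proof
      fix t assume t: "t \<in> {t0..t1}"
      have "((\<lambda>t. bracket (J n t) D) has_vector_derivative bracket (J (Suc n) t) D) (at t within {t0..t1})"
        using Suc t by (intro bounded_linear.has_vector_derivative[OF bracket.bounded_linear_left]) auto
      then show "((\<lambda>t. bracket (J n t) D + cd n S t) has_vector_derivative
          bracket (J (Suc n) t) D + cd (Suc n) S t) (at t within {t0..t1})"
        using derivs_to_curve_deriv[OF assms(4), of n] t by (intro has_vector_derivative_add) auto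
    qed
    then show ?case
      by (simp only: J_simps)
  qed
  have "derivs_to (G n) (G (Suc n))" for n
    using assms(1,2) J[of "n - 2"] by (auto simp: G_def J_simps split: nat.split)
  note G = jet[of G, OF this]
  have G0: "G 0 = f"
    by (simp add: G_def)
  have cd: "cd n f t = G n t" if "t \<in> {t0..t1}" for n t
    using G(2)[OF that, of n] by (simp only: G0)
  show "t \<in> {t0..t1} \<Longrightarrow> cd 1 f t = p1 t" "t \<in> {t0..t1} \<Longrightarrow> cd 2 f t = p2 t"
    by (simp_all add: cd G_def J_simps numeral_2_eq_2)
  show "lie_ode f (\<lambda>_. D) S"
    using G(1) assms(4)
    by (simp add: lie_ode_def smooth_const cd G0)
       (simp add: G_def J_simps numeral_2_eq_2 numeral_3_eq_3)
qed

text \<open>The response to the source \<open>R\<close> from rest. Naming the derivatives as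
  witnesses makes superposition a matter of adding and scaling them.\<close>

definition forced :: "(real \<Rightarrow> so3) \<Rightarrow> (real \<Rightarrow> so3) \<Rightarrow> bool"
  where "forced f R \<longleftrightarrow> (\<exists>p1 p2. derivs_to f p1 \<and> derivs_to p1 p2 \<and>
    derivs_to p2 (\<lambda>t. bracket (p2 t) D + R t) \<and> f t0 = 0 \<and> p1 t0 = 0 \<and> p2 t0 = 0)"

lemma forcedI:
  assumes "derivs_to f p1" "derivs_to p1 p2" "derivs_to p2 p3"
    "\<And>t. t \<in> {t0..t1} \<Longrightarrow> p3 t = bracket (p2 t) D + R t" "f t0 = 0" "p1 t0 = 0" "p2 t0 = 0"
  shows "forced f R"
proof -
  have "derivs_to p2 (\<lambda>t. bracket (p2 t) D + R t)"
    using assms(3) by (rule derivs_to_cong) (simp_all add: assms(4))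
  then show ?thesis
    using assms unfolding forced_def by blast
qed

lemma forced_add:
  assumes "forced f R" "forced g S"
  shows "forced (\<lambda>t. f t + g t) (\<lambda>t. R t + S t)"
proof -
  obtain p1 p2 where f: "derivs_to f p1" "derivs_to p1 p2" "derivs_to p2 (\<lambda>t. bracket (p2 t) D + R t)"
    "f t0 = 0" "p1 t0 = 0" "p2 t0 = 0"
    using assms(1) by (auto simp: forced_def)
  obtain g1 g2 where g: "derivs_to g g1" "derivs_to g1 g2" "derivs_to g2 (\<lambda>t. bracket (g2 t) D + S t)"
    "g t0 = 0" "g1 t0 = 0" "g2 t0 = 0"
    using assms(2) by (auto simp: forced_def)
  show ?thesis
    by (rule forcedI[OF derivs_to_add[OF f(1) g(1)] derivs_to_add[OF f(2) g(2)] derivs_to_add[OF f(3) g(3)]])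
       (simp_all add: f g bracket.add_left)
qed

lemma forced_scaleR:
  assumes "forced f R"
  shows "forced (\<lambda>t. c *\<^sub>R f t) (\<lambda>t. c *\<^sub>R R t)"
proof -
  obtain p1 p2 where f: "derivs_to f p1" "derivs_to p1 p2" "derivs_to p2 (\<lambda>t. bracket (p2 t) D + R t)"
    "f t0 = 0" "p1 t0 = 0" "p2 t0 = 0"
    using assms(1) by (auto simp: forced_def)
  note scale = derivs_to_linear[OF bounded_linear_scaleR_right[of c]]
  show ?thesis
    by (rule forcedI[OF scale[OF f(1)] scale[OF f(2)] scale[OF f(3)]])
       (simp_all add: f bracket.scaleR_left scaleR_add_right)
qed

lemma forced_cong:
  assumes "forced f R" "\<And>t. t \<in> {t0..t1} \<Longrightarrow> f t = g t" "\<And>t. t \<in> {t0..t1} \<Longrightarrow> R t = S t"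
  shows "forced g S"
proof -
  obtain p1 p2 where f: "derivs_to f p1" "derivs_to p1 p2" "derivs_to p2 (\<lambda>t. bracket (p2 t) D + R t)"
    "f t0 = 0" "p1 t0 = 0" "p2 t0 = 0"
    using assms(1) by (auto simp: forced_def)
  have "derivs_to g p1"
    using f(1) by (rule derivs_to_cong) (simp_all add: assms(2))
  then show ?thesis
    by (rule forcedI[OF _ f(2,3)]) (use f(4-6) assms(2,3) t0_less_t1 in auto)
qed

lemma forced_second_order:
  assumes "forced Z (\<lambda>t. 2 *\<^sub>R bracket (cd 2 W t) (W t))" "smooth W"
  shows "second_order D W Z"
proof -
  have "smooth (\<lambda>t. 2 *\<^sub>R bracket (cd 2 W t) (W t))"
    using assms(2) by (intro smooth_scaleR smooth_bracket smooth_curve_deriv)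
  moreover obtain Z1 Z2 where Z: "derivs_to Z Z1" "derivs_to Z1 Z2"
    "derivs_to Z2 (\<lambda>t. bracket (Z2 t) D + 2 *\<^sub>R bracket (cd 2 W t) (W t))"
    "Z t0 = 0" "Z1 t0 = 0" "Z2 t0 = 0"
    using assms(1) by (auto simp: forced_def)
  ultimately have *: "lie_ode Z (\<lambda>_. D) (\<lambda>t. 2 *\<^sub>R bracket (cd 2 W t) (W t))"
    "cd 1 Z t0 = 0" "cd 2 Z t0 = 0"
    using lie_odeI[OF Z(1-3)] t0_less_t1 by auto
  moreover have "cd j Z t0 = 0" if "j \<le> 2" for j
  proof -
    consider "j = 0" | "j = 1" | "j = 2"
      using \<open>j \<le> 2\<close> by linarith
    then show ?thesis
      using Z(4) * by cases simp_all
  qed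
  ultimately show ?thesis
    by (simp add: second_order_def)
qed

section \<open>The operators of the closed form as responses to elementary sources\<close>

context
  fixes X :: so3
  assumes X: "X \<in> F0_perp D"
begin

lemma L0_comb: "blinfun_apply (L0 D t0 t) X =
    comb (\<lambda>t. - (t - t0)) (\<lambda>t. d * (t - t0)\<^sup>2 / 2 - 1 / d) (\<lambda>t. 0) (\<lambda>t. 1 / d) X t"
  using d_pos by (simp add: L0_def Let_def comb_def blinfun.bilinear_simps scaleR_add_right
      scaleR_diff_right power2_eq_square diff_divide_distrib scaleR_diff_left mult.left_commute)

lemma L1_comb: "blinfun_apply (L1 D t0 t) X = comb (\<lambda>t. (t - t0)\<^sup>2 / 2 - 3 / d\<^sup>2)
    (\<lambda>t. 2 * (t - t0) / d) (\<lambda>t. 3 / d\<^sup>2) (\<lambda>t. (t - t0) / d) X t"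
  using d_pos by (simp add: L1_def Let_def comb_def blinfun.bilinear_simps scaleR_add_right
      scaleR_diff_right power2_eq_square diff_divide_distrib)

lemma M0_comb: "blinfun_apply (M0 D t0 t) X = comb (\<lambda>t. (t - t0)\<^sup>2 / (2 * d) - 1 / d ^ 3)
    (\<lambda>t. (t - t0) / d\<^sup>2) (\<lambda>t. 1 / d ^ 3) (\<lambda>t. 0) X t"
  using d_pos by (simp add: M0_def Let_def comb_def blinfun.bilinear_simps scaleR_add_right
      scaleR_diff_right power2_eq_square power3_eq_cube diff_divide_distrib)

lemma M1_comb: "blinfun_apply (M1 D t0 t) X =
    comb (\<lambda>t. (t - t0) ^ 3 / (6 * d) - (t - t0) / d ^ 3)
      (\<lambda>t. (t - t0)\<^sup>2 / (2 * d\<^sup>2) - 1 / d ^ 4) (\<lambda>t. 0) (\<lambda>t. 1 / d ^ 4) X t"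
  using d_pos by (simp add: M1_def Let_def comb_def blinfun.bilinear_simps scaleR_add_right
      scaleR_diff_right eval_nat_numeral diff_divide_distrib)

lemma M_B_comb: "blinfun_apply (M_B D t0 t) X = comb (\<lambda>t. - 2 / d ^ 3) (\<lambda>t. (t - t0) / d\<^sup>2)
    (\<lambda>t. 2 / d ^ 3) (\<lambda>t. (t - t0) / d\<^sup>2) X t"
  using d_pos by (simp add: M_B_def Let_def comb_def blinfun.bilinear_simps scaleR_add_right
      scaleR_diff_right power2_eq_square power3_eq_cube diff_divide_distrib)

lemmas i_simps = blinfun.bilinear_simps i_i_perp[OF X] i_i_perp[OF e_in_perp[OF X]]

text \<open>For the constant source \<open>i X\<close> the second derivative is (X - e X) / d, by
  variation of constants; two integrations from \<open>t0\<close> give M0.\<close>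

lemma forced_M0: "forced (\<lambda>t. blinfun_apply (M0 D t0 t) X) (\<lambda>t. i X)"
  unfolding M0_comb
proof (rule forcedI)
  show "derivs_to (comb (\<lambda>t. (t - t0)\<^sup>2 / (2 * d) - 1 / d ^ 3) (\<lambda>t. (t - t0) / d\<^sup>2) (\<lambda>t. 1 / d ^ 3) (\<lambda>t. 0) X)
      (comb (\<lambda>t. (t - t0) / d) (\<lambda>t. 1 / d\<^sup>2) (\<lambda>t. 0) (\<lambda>t. - 1 / d\<^sup>2) X)"
    using d_pos by (intro derivs_to_comb[OF X]) (auto intro!: derivative_eq_intros simp: eval_nat_numeral field_simps)
  show "derivs_to (comb (\<lambda>t. (t - t0) / d) (\<lambda>t. 1 / d\<^sup>2) (\<lambda>t. 0) (\<lambda>t. - 1 / d\<^sup>2) X)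
      (comb (\<lambda>t. 1 / d) (\<lambda>t. 0) (\<lambda>t. - 1 / d) (\<lambda>t. 0) X)"
    using d_pos by (intro derivs_to_comb[OF X]) (auto intro!: derivative_eq_intros simp: eval_nat_numeral field_simps)
  show "derivs_to (comb (\<lambda>t. 1 / d) (\<lambda>t. 0) (\<lambda>t. - 1 / d) (\<lambda>t. 0) X)
      (comb (\<lambda>t. 0) (\<lambda>t. 0) (\<lambda>t. 0) (\<lambda>t. 1) X)"
    using d_pos by (intro derivs_to_comb[OF X]) (auto intro!: derivative_eq_intros)
qed (use d_pos in \<open>simp_all add: comb_t0[OF X], simp_all add: bracket_D comb_def i_simps algebra_simps\<close>)

text \<open>The source is the integral of the one for M0, so M1 is the integral of M0 and its chain
  of derivatives continues with that of M0.\<close>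

lemma forced_M1: "forced (\<lambda>t. blinfun_apply (M1 D t0 t) X) (\<lambda>t. (t - t0) *\<^sub>R i X)"
  unfolding M1_comb
proof (rule forcedI)
  show "derivs_to (comb (\<lambda>t. (t - t0) ^ 3 / (6 * d) - (t - t0) / d ^ 3)
        (\<lambda>t. (t - t0)\<^sup>2 / (2 * d\<^sup>2) - 1 / d ^ 4) (\<lambda>t. 0) (\<lambda>t. 1 / d ^ 4) X)
      (comb (\<lambda>t. (t - t0)\<^sup>2 / (2 * d) - 1 / d ^ 3) (\<lambda>t. (t - t0) / d\<^sup>2) (\<lambda>t. 1 / d ^ 3) (\<lambda>t. 0) X)"
    using d_pos by (intro derivs_to_comb[OF X]) (auto intro!: derivative_eq_intros simp: eval_nat_numeral field_simps)
  show "derivs_to (comb (\<lambda>t. (t - t0)\<^sup>2 / (2 * d) - 1 / d ^ 3) (\<lambda>t. (t - t0) / d\<^sup>2) (\<lambda>t. 1 / d ^ 3) (\<lambda>t. 0) X)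
      (comb (\<lambda>t. (t - t0) / d) (\<lambda>t. 1 / d\<^sup>2) (\<lambda>t. 0) (\<lambda>t. - 1 / d\<^sup>2) X)"
    using d_pos by (intro derivs_to_comb[OF X]) (auto intro!: derivative_eq_intros simp: eval_nat_numeral field_simps)
  show "derivs_to (comb (\<lambda>t. (t - t0) / d) (\<lambda>t. 1 / d\<^sup>2) (\<lambda>t. 0) (\<lambda>t. - 1 / d\<^sup>2) X)
      (comb (\<lambda>t. 1 / d) (\<lambda>t. 0) (\<lambda>t. - 1 / d) (\<lambda>t. 0) X)"
    using d_pos by (intro derivs_to_comb[OF X]) (auto intro!: derivative_eq_intros simp: eval_nat_numeral field_simps)
qed (use d_pos in \<open>simp_all add: comb_t0[OF X],
  simp_all add: bracket_D comb_def i_simps algebra_simps power2_eq_square diff_divide_distrib\<close>)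

text \<open>Resonance: the source solves the homogeneous equation, so the second derivative carries
  the secular factor t - t0. This is where the term with u in M_B originates.\<close>

lemma forced_M_B: "forced (\<lambda>t. blinfun_apply (M_B D t0 t) X) (\<lambda>t. - i (e X t))"
  unfolding M_B_comb
proof (rule forcedI)
  show "derivs_to (comb (\<lambda>t. - 2 / d ^ 3) (\<lambda>t. (t - t0) / d\<^sup>2) (\<lambda>t. 2 / d ^ 3) (\<lambda>t. (t - t0) / d\<^sup>2) X)
      (comb (\<lambda>t. 0) (\<lambda>t. 1 / d\<^sup>2) (\<lambda>t. (t - t0) / d) (\<lambda>t. - 1 / d\<^sup>2) X)"
    using d_pos by (intro derivs_to_comb[OF X]) (auto intro!: derivative_eq_intros simp: eval_nat_numeral field_simps)
  show "derivs_to (comb (\<lambda>t. 0) (\<lambda>t. 1 / d\<^sup>2) (\<lambda>t. (t - t0) / d) (\<lambda>t. - 1 / d\<^sup>2) X)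
      (comb (\<lambda>t. 0) (\<lambda>t. 0) (\<lambda>t. 0) (\<lambda>t. - (t - t0)) X)"
    using d_pos by (intro derivs_to_comb[OF X]) (auto intro!: derivative_eq_intros simp: eval_nat_numeral field_simps)
  show "derivs_to (comb (\<lambda>t. 0) (\<lambda>t. 0) (\<lambda>t. 0) (\<lambda>t. - (t - t0)) X)
      (comb (\<lambda>t. 0) (\<lambda>t. 0) (\<lambda>t. - d * (t - t0)) (\<lambda>t. - 1) X)"
    by (intro derivs_to_comb[OF X]) (auto intro!: derivative_eq_intros simp: algebra_simps)
qed (use d_pos in \<open>simp_all add: comb_t0[OF X], simp_all add: bracket_D comb_def i_simps algebra_simps\<close>)

text \<open>The bracket of two vectors orthogonal to \<open>D\<close> is parallel to \<open>D\<close>, so it does not feel the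
  homogeneous part of the equation.\<close>

lemma forced_bracket:
  assumes A: "A \<in> F0_perp D" and "derivs_to f p1" "derivs_to p1 p2" "derivs_to p2 p3"
    "f t0 = 0" "p1 t0 = 0" "p2 t0 = 0" and perp: "\<And>t. p2 t \<in> F0_perp D"
  shows "forced (\<lambda>t. bracket A (f t)) (\<lambda>t. bracket A (p3 t))"
proof -
  note lin = derivs_to_linear[OF bracket.bounded_linear_right[of A]]
  \<comment> \<open>\<open>bracket A (p2 t)\<close> is a multiple of F, and D is one too.\<close>
  have "bracket (bracket A (p2 t)) D = 0" for t
    using bracket_perp[OF A perp, of t] i_F by (metis blinfun.scaleR_right bracket_D scaleR_zero_right neg_equal_zero minus_zero)
  then show ?thesis
    by (intro forcedI[OF lin[OF assms(2)] lin[OF assms(3)] lin[OF assms(4)]])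
       (simp_all add: assms(5-7) bracket.zero_right)
qed

text \<open>L0 X is the threefold integral from \<open>t0\<close> of - d^2 e X, and L1 X that of -
  d^2 (t - t0) e X.\<close>

lemma forced_L0:
  assumes "A \<in> F0_perp D"
  shows "forced (\<lambda>t. bracket A (blinfun_apply (L0 D t0 t) X)) (\<lambda>t. - (d\<^sup>2 *\<^sub>R bracket A (e X t)))"
proof -
  have "forced (\<lambda>t. bracket A (blinfun_apply (L0 D t0 t) X))
      (\<lambda>t. bracket A (comb (\<lambda>t. 0) (\<lambda>t. 0) (\<lambda>t. - d\<^sup>2) (\<lambda>t. 0) X t))"
    unfolding L0_comb
  proof (rule forced_bracket[OF assms])
    show "derivs_to (comb (\<lambda>t. - (t - t0)) (\<lambda>t. d * (t - t0)\<^sup>2 / 2 - 1 / d) (\<lambda>t. 0) (\<lambda>t. 1 / d) X)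
        (comb (\<lambda>t. - 1) (\<lambda>t. d * (t - t0)) (\<lambda>t. 1) (\<lambda>t. 0) X)"
      using d_pos by (intro derivs_to_comb[OF X]) (auto intro!: derivative_eq_intros)
    show "derivs_to (comb (\<lambda>t. - 1) (\<lambda>t. d * (t - t0)) (\<lambda>t. 1) (\<lambda>t. 0) X)
        (comb (\<lambda>t. 0) (\<lambda>t. d) (\<lambda>t. 0) (\<lambda>t. - d) X)"
      using d_pos by (intro derivs_to_comb[OF X]) (auto intro!: derivative_eq_intros)
    show "derivs_to (comb (\<lambda>t. 0) (\<lambda>t. d) (\<lambda>t. 0) (\<lambda>t. - d) X)
        (comb (\<lambda>t. 0) (\<lambda>t. 0) (\<lambda>t. - d\<^sup>2) (\<lambda>t. 0) X)"
      by (intro derivs_to_comb[OF X]) (auto intro!: derivative_eq_intros simp: power2_eq_square)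
  qed (simp_all add: comb_t0[OF X] comb_perp[OF X])
  then show ?thesis
    by (simp add: comb_def bracket.scaleR_right bracket.minus_right)
qed

lemma forced_L1:
  assumes "A \<in> F0_perp D"
  shows "forced (\<lambda>t. bracket A (blinfun_apply (L1 D t0 t) X))
    (\<lambda>t. - ((d\<^sup>2 * (t - t0)) *\<^sub>R bracket A (e X t)))"
proof -
  have "forced (\<lambda>t. bracket A (blinfun_apply (L1 D t0 t) X))
      (\<lambda>t. bracket A (comb (\<lambda>t. 0) (\<lambda>t. 0) (\<lambda>t. - (d\<^sup>2 * (t - t0))) (\<lambda>t. 0) X t))"
    unfolding L1_comb
  proof (rule forced_bracket[OF assms])
    show "derivs_to (comb (\<lambda>t. (t - t0)\<^sup>2 / 2 - 3 / d\<^sup>2) (\<lambda>t. 2 * (t - t0) / d) (\<lambda>t. 3 / d\<^sup>2) (\<lambda>t. (t - t0) / d) X)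
        (comb (\<lambda>t. t - t0) (\<lambda>t. 2 / d) (\<lambda>t. t - t0) (\<lambda>t. - 2 / d) X)"
      using d_pos by (intro derivs_to_comb[OF X])
        (auto intro!: derivative_eq_intros simp: power2_eq_square field_simps)
    show "derivs_to (comb (\<lambda>t. t - t0) (\<lambda>t. 2 / d) (\<lambda>t. t - t0) (\<lambda>t. - 2 / d) X)
        (comb (\<lambda>t. 1) (\<lambda>t. 0) (\<lambda>t. - 1) (\<lambda>t. - d * (t - t0)) X)"
      using d_pos by (intro derivs_to_comb[OF X]) (auto intro!: derivative_eq_intros)
    show "derivs_to (comb (\<lambda>t. 1) (\<lambda>t. 0) (\<lambda>t. - 1) (\<lambda>t. - d * (t - t0)) X)
        (comb (\<lambda>t. 0) (\<lambda>t. 0) (\<lambda>t. - (d\<^sup>2 * (t - t0))) (\<lambda>t. 0) X)"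
      by (intro derivs_to_comb[OF X]) (auto intro!: derivative_eq_intros simp: power2_eq_square)
  qed (simp_all add: comb_t0[OF X] comb_perp[OF X])
  then show ?thesis
    by (simp add: comb_def bracket.scaleR_right bracket.minus_right)
qed

end

end

context time_interval
begin

lemma q_poly_derivs:
  "derivs_to (q_poly c0 c1 c2 t0) (\<lambda>t. c1 + 2 * c2 * (t - t0))"
  "derivs_to (\<lambda>t. c1 + 2 * c2 * (t - t0)) (\<lambda>t. 2 * c2)"
  unfolding q_poly_def has_real_derivative_iff_has_vector_derivative[symmetric]
  by (auto intro!: derivative_eq_intros)

lemma curve_deriv_2_q_poly:
  assumes t: "t \<in> {t0..t1}"
  shows "cd 2 (q_poly c0 c1 c2 t0) t = 2 * c2"
proof -
  have "cd 2 (q_poly c0 c1 c2 t0) t = cd (Suc 0) (cd (Suc 0) (q_poly c0 c1 c2 t0)) t"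
    unfolding curve_deriv_add[symmetric] by (simp add: numeral_2_eq_2)
  also have "\<dots> = cd (Suc 0) (\<lambda>t. c1 + 2 * c2 * (t - t0)) t"
    by (rule curve_deriv_cong[OF _ t]) (rule derivs_to_eq[OF q_poly_derivs(1)])
  also have "\<dots> = 2 * c2"
    by (rule derivs_to_eq[OF q_poly_derivs(2) t])
  finally show ?thesis .
qed

lemma first_order_cong:
  assumes "first_order V D W" "\<And>t. t \<in> {t0..t1} \<Longrightarrow> W t = W' t"
  shows "first_order V D W'"
proof -
  have "cd j W' t = cd j W t" if "t \<in> {t0..t1}" for j t
    using curve_deriv_cong[OF assms(2) that] by simp
  moreover have "smooth W'"
    using assms smooth_cong unfolding first_order_def lie_ode_def by blast
  ultimately show ?thesis
    using assms(1) t0_less_t1 by (simp add: first_order_def lie_ode_def)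
qed

end

section \<open>The first and second variations in closed form\<close>

context constant_quadratic
begin

text \<open>Variation of constants with Q = I(q): the second derivative is Q i e X. Differentiating
  Q produces the source, and differentiating i e X produces d Q e X, which is the bracket of Q i e X
  with D.\<close>

lemma forced_integral:
  assumes X: "X \<in> F0_perp D" and q: "continuous_on {t0..t1} q"
  shows "forced (\<lambda>t. i (blinfun_apply (I_op t0 (I_op t0 (\<lambda>s. I_op t0 q s *\<^sub>R e_til D t0 s)) t) X))
    (\<lambda>t. q t *\<^sub>R i (e X t))"
proof -
  let ?Q = "I_op t0 q" and ?g = "\<lambda>s. I_op t0 q s *\<^sub>R e_til D t0 s"
  note Q = derivs_to_I_op[OF q]
  have "continuous_on {t0..t1} ?g"
    unfolding e_til_eq by (intro continuous_intros derivs_to_continuous[OF Q])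
  note J1 = derivs_to_I_op[OF this]
  note J2 = derivs_to_I_op[OF derivs_to_continuous[OF J1]]
  have lin: "bounded_linear (\<lambda>T. i (blinfun_apply T X))"
    by (intro bounded_linear_compose[OF blinfun.bounded_linear_right blinfun.bounded_linear_left])
  have comb: "comb (\<lambda>t. 0) (\<lambda>t. 0) (\<lambda>t. 0) (\<lambda>t. 1) X = (\<lambda>t. i (e X t))"
    "comb (\<lambda>t. 0) (\<lambda>t. 0) (\<lambda>t. d) (\<lambda>t. 0) X = (\<lambda>t. d *\<^sub>R e X t)"
    by (simp_all add: comb_def fun_eq_iff)
  have "derivs_to (comb (\<lambda>t. 0) (\<lambda>t. 0) (\<lambda>t. 0) (\<lambda>t. 1) X) (comb (\<lambda>t. 0) (\<lambda>t. 0) (\<lambda>t. d) (\<lambda>t. 0) X)"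
    by (intro derivs_to_comb[OF X]) (auto intro!: derivative_eq_intros)
  then have ie: "derivs_to (\<lambda>t. i (e X t)) (\<lambda>t. d *\<^sub>R e X t)"
    by (simp only: comb)
  have "derivs_to (\<lambda>t. ?Q t *\<^sub>R i (e X t)) (\<lambda>t. ?Q t *\<^sub>R (d *\<^sub>R e X t) + q t *\<^sub>R i (e X t))"
    by (rule derivs_to_bilinear[OF bounded_bilinear_scaleR Q ie])
  moreover have "i (blinfun_apply (?g t) X) = ?Q t *\<^sub>R i (e X t)" for t
    by (simp add: blinfun.bilinear_simps)
  ultimately have third: "derivs_to (\<lambda>t. i (blinfun_apply (?g t) X))
      (\<lambda>t. ?Q t *\<^sub>R (d *\<^sub>R e X t) + q t *\<^sub>R i (e X t))"
    by simp
  show ?thesis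
    by (rule forcedI[OF derivs_to_linear[OF lin J2] derivs_to_linear[OF lin J1] third])
      (simp_all add: bracket_D blinfun.bilinear_simps i_i_perp[OF e_in_perp[OF X]] mult.commute)
qed

context
  fixes c0 c1 c2 :: real and A0 A1 B :: so3
  assumes A0: "A0 \<in> F0_perp D" and A1: "A1 \<in> F0_perp D" and B: "B \<in> F0_perp D"
begin

abbreviation q :: "real \<Rightarrow> real"
  where "q \<equiv> q_poly c0 c1 c2 t0"

abbreviation W :: "real \<Rightarrow> so3"
  where "W \<equiv> first_variation D t0 q A0 A1 B"

lemma
  shows first_variation_ode: "lie_ode W (\<lambda>_. D) (\<lambda>_. 0)"
    and first_variation_1: "t \<in> {t0..t1} \<Longrightarrow>
      cd 1 W t = (c1 + 2 * c2 * (t - t0)) *\<^sub>R F + A1 - d *\<^sub>R i (e B t)"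
    and first_variation_2: "t \<in> {t0..t1} \<Longrightarrow> cd 2 W t = (2 * c2) *\<^sub>R F - d\<^sup>2 *\<^sub>R e B t"
proof -
  have comb: "comb (\<lambda>t. 0) (\<lambda>t. 0) (\<lambda>t. 1) (\<lambda>t. 0) B = (\<lambda>t. e B t)"
    "comb (\<lambda>t. 0) (\<lambda>t. 0) (\<lambda>t. 0) (\<lambda>t. - d) B = (\<lambda>t. - (d *\<^sub>R i (e B t)))"
    "comb (\<lambda>t. 0) (\<lambda>t. 0) (\<lambda>t. - d\<^sup>2) (\<lambda>t. 0) B = (\<lambda>t. - (d\<^sup>2 *\<^sub>R e B t))"
    "comb (\<lambda>t. 0) (\<lambda>t. 0) (\<lambda>t. 0) (\<lambda>t. d ^ 3) B = (\<lambda>t. d ^ 3 *\<^sub>R i (e B t))"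
    by (simp_all add: comb_def fun_eq_iff)
  have "derivs_to (comb (\<lambda>t. 0) (\<lambda>t. 0) (\<lambda>t. 1) (\<lambda>t. 0) B) (comb (\<lambda>t. 0) (\<lambda>t. 0) (\<lambda>t. 0) (\<lambda>t. - d) B)"
    "derivs_to (comb (\<lambda>t. 0) (\<lambda>t. 0) (\<lambda>t. 0) (\<lambda>t. - d) B) (comb (\<lambda>t. 0) (\<lambda>t. 0) (\<lambda>t. - d\<^sup>2) (\<lambda>t. 0) B)"
    "derivs_to (comb (\<lambda>t. 0) (\<lambda>t. 0) (\<lambda>t. - d\<^sup>2) (\<lambda>t. 0) B) (comb (\<lambda>t. 0) (\<lambda>t. 0) (\<lambda>t. 0) (\<lambda>t. d ^ 3) B)"
    by (rule derivs_to_comb[OF B]; (rule derivative_intros)?; simp add: eval_nat_numeral)+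
  then have e: "derivs_to (\<lambda>t. e B t) (\<lambda>t. - (d *\<^sub>R i (e B t)))"
    "derivs_to (\<lambda>t. - (d *\<^sub>R i (e B t))) (\<lambda>t. - (d\<^sup>2 *\<^sub>R e B t))"
    "derivs_to (\<lambda>t. - (d\<^sup>2 *\<^sub>R e B t)) (\<lambda>t. d ^ 3 *\<^sub>R i (e B t))"
    by (simp_all only: comb)
  have scale: "derivs_to (\<lambda>t. x t *\<^sub>R F) (\<lambda>t. x' t *\<^sub>R F)" if "derivs_to x x'" for x x'
    using that by (intro derivs_to_linear[OF bounded_linear_scaleR_left])
  have "derivs_to (\<lambda>t. A0 + (t - t0) *\<^sub>R A1) (\<lambda>t. A1)"
    by (auto intro!: derivative_eq_intros)
  from derivs_to_add[OF derivs_to_add[OF scale[OF q_poly_derivs(1)[of c0 c1 c2]] this] e(1)]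
  have 1: "derivs_to W (\<lambda>t. (c1 + 2 * c2 * (t - t0)) *\<^sub>R F + A1 + - (d *\<^sub>R i (e B t)))"
    by (rule derivs_to_cong) (simp_all add: first_variation_def)
  have "derivs_to (\<lambda>t. A1) (\<lambda>t. 0)"
    by (auto intro!: derivative_eq_intros)
  from derivs_to_add[OF derivs_to_add[OF scale[OF q_poly_derivs(2)[of c1 c2]] this] e(2)]
  have 2: "derivs_to (\<lambda>t. (c1 + 2 * c2 * (t - t0)) *\<^sub>R F + A1 + - (d *\<^sub>R i (e B t)))
      (\<lambda>t. (2 * c2) *\<^sub>R F + - (d\<^sup>2 *\<^sub>R e B t))"
    by (rule derivs_to_cong) simp_all
  have "derivs_to (\<lambda>t. (2 * c2) *\<^sub>R F) (\<lambda>t. 0)"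
    by (auto intro!: derivative_eq_intros)
  from derivs_to_add[OF this e(3)]
  have 3: "derivs_to (\<lambda>t. (2 * c2) *\<^sub>R F + - (d\<^sup>2 *\<^sub>R e B t))
      (\<lambda>t. bracket ((2 * c2) *\<^sub>R F + - (d\<^sup>2 *\<^sub>R e B t)) D + 0)"
    by (rule derivs_to_cong) (simp_all add: bracket_D blinfun.bilinear_simps eval_nat_numeral)
  note W = lie_odeI[OF 1 2 3 smooth_const]
  show "lie_ode W (\<lambda>_. D) (\<lambda>_. 0)"
    by (rule W(1))
  show "t \<in> {t0..t1} \<Longrightarrow> cd 1 W t = (c1 + 2 * c2 * (t - t0)) *\<^sub>R F + A1 - d *\<^sub>R i (e B t)"
    "t \<in> {t0..t1} \<Longrightarrow> cd 2 W t = (2 * c2) *\<^sub>R F - d\<^sup>2 *\<^sub>R e B t"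
    using W(2,3) by simp_all
qed

text \<open>Inserting W'' = 2 c2 F - d^2 e B into 2 [W'', W] leaves brackets of A0 and A1 with e B,
  parallel to F and answered by L0 and L1; terms with c2, answered by M0, M1 and M_B; and 2 d^2 q i
  e B, answered by the iterated integral.\<close>

lemma second_variation:
  "second_order D W (\<lambda>t. f2 D t0 A0 A1 B t *\<^sub>R F + v2 D t0 t1 q A0 A1 B t)"
proof (rule forced_second_order)
  show "smooth W"
    using first_variation_ode by (rule lie_odeD)
  have "continuous_on {t0..t1} q"
    by (rule derivs_to_continuous[OF q_poly_derivs(1)])
  note N = forced_integral[OF B this]
  note L = forced_scaleR[OF forced_add[OF forced_L0[OF B A0] forced_L1[OF B A1]], of "- 2"]
  \<comment> \<open>The factor \<open>4 * c2\<close> is twice the second derivative of q; M_B enters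
    with - 1 because its source is - i e B.\<close>
  note M = forced_scaleR[OF forced_add[OF forced_add[OF forced_M0[OF A0] forced_M1[OF A1]]
        forced_scaleR[OF forced_M_B[OF B], of "- 1"]], of "4 * c2"]
  show "forced (\<lambda>t. f2 D t0 A0 A1 B t *\<^sub>R F + v2 D t0 t1 q A0 A1 B t)
      (\<lambda>t. 2 *\<^sub>R bracket (cd 2 W t) (W t))"
  proof (rule forced_cong[OF forced_add[OF forced_add[OF L M] forced_scaleR[OF N, of "2 * d\<^sup>2"]]])
    fix t assume t: "t \<in> {t0..t1}"
    let ?P = "bracket A0 (blinfun_apply (L0 D t0 t) B)" and ?Q = "bracket A1 (blinfun_apply (L1 D t0 t) B)"
    have par: "inner ?P F *\<^sub>R F = ?P" "inner ?Q F *\<^sub>R F = ?Q"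
      unfolding L0_comb[OF B] L1_comb[OF B] by (intro bracket_perp A0 A1 comb_perp B)+
    have "f2 D t0 A0 A1 B t *\<^sub>R F = - 2 *\<^sub>R (inner ?P F *\<^sub>R F + inner ?Q F *\<^sub>R F)"
      by (simp add: f2_def inner_add_left flip: scaleR_add_left)
    then have "f2 D t0 A0 A1 B t *\<^sub>R F = - 2 *\<^sub>R (?P + ?Q)"
      unfolding par .
    then show "- 2 *\<^sub>R (?P + ?Q)
        + (4 * c2) *\<^sub>R (blinfun_apply (M0 D t0 t) A0 + blinfun_apply (M1 D t0 t) A1
            + - 1 *\<^sub>R blinfun_apply (M_B D t0 t) B)
        + (2 * d\<^sup>2) *\<^sub>R i (blinfun_apply (I_op t0 (I_op t0 (\<lambda>s. I_op t0 q s *\<^sub>R e_til D t0 s)) t) B)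
        = f2 D t0 A0 A1 B t *\<^sub>R F + v2 D t0 t1 q A0 A1 B t"
      by (simp add: v2_def curve_deriv_2_q_poly[OF t])
    have skew: "bracket (e B t) F = - bracket F (e B t)" "bracket (e B t) A0 = - bracket A0 (e B t)"
      "bracket (e B t) A1 = - bracket A1 (e B t)"
      by (rule bracket_skew)+
    show "- 2 *\<^sub>R (- (d\<^sup>2 *\<^sub>R bracket A0 (e B t)) + - ((d\<^sup>2 * (t - t0)) *\<^sub>R bracket A1 (e B t)))
        + (4 * c2) *\<^sub>R (i A0 + (t - t0) *\<^sub>R i A1 + - 1 *\<^sub>R - i (e B t))
        + (2 * d\<^sup>2) *\<^sub>R (q t *\<^sub>R i (e B t)) = 2 *\<^sub>R bracket (cd 2 W t) (W t)"
      unfolding first_variation_2[OF t]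
      by (simp add: first_variation_def bracket.add_right bracket.diff_left bracket.scaleR_left
          bracket.scaleR_right i_eq skew scaleR_add_right scaleR_diff_right mult_ac)
  qed
qed

end

text \<open>The components of the prescribed data along F fix q, with c2 half the component of the
  second derivative.\<close>

lemma first_variation_exists:
  assumes V: "variation V D"
  obtains c0 c1 c2 A0 A1 B where "A0 \<in> F0_perp D" "A1 \<in> F0_perp D" "B \<in> F0_perp D"
    "first_order V D (first_variation D t0 (q_poly c0 c1 c2 t0) A0 A1 B)"
proof -
  obtain b where b: "\<And>j h. j \<le> 2 \<Longrightarrow> h \<in> {-1..1}
      \<Longrightarrow> cd j (V h) t0 = (if j = 0 then D else 0) + h *\<^sub>R b j"
    using variation_init[OF V] by metis
  \<comment> \<open>Orthogonally to F, the data at \<open>t0\<close> read W'' = - d^2 B, W' = A1 - d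
    i B and W = A0 + B; the system is solved from the highest derivative down.\<close>
  define B where "B = - ((1 / d\<^sup>2) *\<^sub>R (b 2 - inner (b 2) F *\<^sub>R F))"
  define A1 where "A1 = (b 1 - inner (b 1) F *\<^sub>R F) + d *\<^sub>R i B"
  define A0 where "A0 = (b 0 - inner (b 0) F *\<^sub>R F) - B"
  let ?W = "first_variation D t0 (q_poly (inner (b 0) F) (inner (b 1) F) (inner (b 2) F / 2) t0) A0 A1 B"
  have B: "B \<in> F0_perp D"
    unfolding B_def by (simp add: F0_perp_def inner_diff_left)
  have A1: "A1 \<in> F0_perp D"
    unfolding A1_def by (intro add_perp perp_part scaleR_perp i_perp)
  have A0: "A0 \<in> F0_perp D"
    unfolding A0_def by (intro diff_perp perp_part B)
  have "?W t0 = b 0"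
    by (simp add: first_variation_def q_poly_def e_t0[OF B] A0_def)
  moreover have "cd 1 ?W t0 = b 1"
    using t0_less_t1 by (subst first_variation_1[OF A0 A1 B]) (simp_all add: e_t0[OF B] A1_def)
  moreover have "cd 2 ?W t0 = b 2"
    using t0_less_t1 d_pos by (simp add: first_variation_2[OF A0 A1 B] e_t0[OF B]) (simp add: B_def)
  ultimately have init: "cd j ?W t0 = b j" if "j \<le> 2" for j
  proof -
    consider "j = 0" | "j = 1" | "j = 2"
      using \<open>j \<le> 2\<close> by linarith
    then show ?thesis
      using \<open>?W t0 = b 0\<close> \<open>cd 1 ?W t0 = b 1\<close> \<open>cd 2 ?W t0 = b 2\<close> by cases simp_all
  qed
  have "first_order V D ?W"
    using first_variation_ode[OF A0 A1 B] b by (simp add: first_order_def init del: One_nat_def)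
  then show thesis
    by (rule that[OF A0 A1 B])
qed

end

theorem theorem3:
  fixes d t0 t1 :: real
  assumes "t0 < t1"
  shows
    "(\<forall>V D c0 c1 c2 A0 A1 B \<delta>.
        lie_quadratic_variation t0 t1 V D \<longrightarrow> norm D = d \<longrightarrow>
        A0 \<in> F0_perp D \<longrightarrow> A1 \<in> F0_perp D \<longrightarrow> B \<in> F0_perp D \<longrightarrow>
        (\<forall>t\<in>{t0..t1}. mixed_deriv t0 t1 1 0 V 0 t
            = first_variation D t0 (q_poly c0 c1 c2 t0) A0 A1 B t) \<longrightarrow>
        \<delta> \<in> {0<..<1} \<longrightarrow>
        (\<forall>t\<in>{t0..t1}. V_hat2 t0 t1 V \<delta> t =
            D + \<delta> *\<^sub>R (q_poly c0 c1 c2 t0 t *\<^sub>R F0 D + A0 + (t - t0) *\<^sub>R A1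
                       + blinfun_apply (e_til D t0 t) B)
              + (\<delta>\<^sup>2 / 2) *\<^sub>R (f2 D t0 A0 A1 B t *\<^sub>R F0 D
                       + v2 D t0 t1 (q_poly c0 c1 c2 t0) A0 A1 B t)))
     \<and> (\<forall>j. \<exists>K. \<forall>V D \<delta>.
        lie_quadratic_variation t0 t1 V D \<longrightarrow> norm D = d \<longrightarrow> \<delta> \<in> {0<..<1} \<longrightarrow>
        (\<forall>t\<in>{t0..t1}. norm (curve_deriv t0 t1 j (V \<delta>) t
            - curve_deriv t0 t1 j (V_hat2 t0 t1 V \<delta>) t) \<le> K * \<delta> ^ 3))"
proof (intro conjI allI impI ballI)
  interpret time_interval t0 t1
    by unfold_locales (rule assms)
  fix V D c0 c1 c2 A0 A1 B \<delta> t
  assume V: "lie_quadratic_variation t0 t1 V D" and A0: "A0 \<in> F0_perp D" and A1: "A1 \<in> F0_perp D"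
    and B: "B \<in> F0_perp D" and W_eq: "\<forall>t\<in>{t0..t1}. mixed_deriv t0 t1 1 0 V 0 t
            = first_variation D t0 (q_poly c0 c1 c2 t0) A0 A1 B t" and t: "t \<in> {t0..t1}"
  interpret constant_quadratic t0 t1 D
    by unfold_locales (use V in \<open>simp add: lie_quadratic_variation_def\<close>)
  \<comment> \<open>The primed constants are never compared with the given ones. Both curves equal
    the first derivative of V in h, so the given one inherits the equation and the initial
    data.\<close>
  obtain c0' c1' c2' A0' A1' B'
    where W': "first_order V D (first_variation D t0 (q_poly c0' c1' c2' t0) A0' A1' B')"
    by (rule first_variation_exists[OF V])
  have W: "first_order V D (first_variation D t0 (q_poly c0 c1 c2 t0) A0 A1 B)"
    by (rule first_order_cong[OF W']) (simp only: first_order_unique[OF V W', symmetric] W_eq)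
  show "V_hat2 t0 t1 V \<delta> t =
      D + \<delta> *\<^sub>R (q_poly c0 c1 c2 t0 t *\<^sub>R F0 D + A0 + (t - t0) *\<^sub>R A1
                 + blinfun_apply (e_til D t0 t) B)
        + (\<delta>\<^sup>2 / 2) *\<^sub>R (f2 D t0 A0 A1 B t *\<^sub>R F0 D
                 + v2 D t0 t1 (q_poly c0 c1 c2 t0) A0 A1 B t)"
    unfolding V_hat2_def variation_0[OF V t] first_order_unique[OF V W t]
      second_order_unique[OF V W second_variation[OF A0 A1 B] t]
    by (simp add: first_variation_def)
next
  interpret time_interval t0 t1
    by unfold_locales (rule assms)
  fix j
  obtain K where K: "\<And>V D W Z h. h \<in> {-1..1} \<Longrightarrow> variation V D \<Longrightarrow> first_order V D W
      \<Longrightarrow> second_order D W Z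
      \<Longrightarrow> derivs_le j (K * \<bar>h\<bar> ^ 3) (\<lambda>t. V h t - D - h *\<^sub>R W t - (h\<^sup>2 / 2) *\<^sub>R Z t)"
    using expansion_2[of j] by blast
  have "norm (cd j (V \<delta>) t - cd j (V_hat2 t0 t1 V \<delta>) t) \<le> K * \<delta> ^ 3"
    if V: "variation V D" and \<delta>: "\<delta> \<in> {0<..<1}" and t: "t \<in> {t0..t1}" for V D \<delta> t
  proof -
    interpret constant_quadratic t0 t1 D
      by unfold_locales (use V in \<open>simp add: lie_quadratic_variation_def\<close>)
    obtain c0 c1 c2 A0 A1 B where perp: "A0 \<in> F0_perp D" "A1 \<in> F0_perp D" "B \<in> F0_perp D"
      and "first_order V D (first_variation D t0 (q_poly c0 c1 c2 t0) A0 A1 B)"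
      by (rule first_variation_exists[OF V])
    \<comment> \<open>From here the closed form is forgotten: only the existence of W and Z matters,
      and the constant comes from \<open>expansion_2\<close>.\<close>
    then obtain W Z where W: "first_order V D W" and Z: "second_order D W Z"
      using second_variation[OF perp] by blast
    have h: "\<delta> \<in> {-1..1}"
      using \<delta> by simp
    let ?Y = "\<lambda>t. D + \<delta> *\<^sub>R W t + (\<delta>\<^sup>2 / 2) *\<^sub>R Z t"
    have smooth: "smooth (V \<delta>)" "smooth ?Y"
      using variation_smooth[OF V h] W Z
      by (auto simp: first_order_def second_order_def lie_ode_def
          intro!: smooth_add smooth_scaleR smooth_const)
    have "V_hat2 t0 t1 V \<delta> s = ?Y s" if s: "s \<in> {t0..t1}" for s
      unfolding V_hat2_def
      by (simp only: variation_0[OF V s] first_order_unique[OF V W s] second_order_unique[OF V W Z s])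
    then have "cd j (V_hat2 t0 t1 V \<delta>) t = cd j ?Y t"
      using t by (rule curve_deriv_cong)
    then have "cd j (V \<delta>) t - cd j (V_hat2 t0 t1 V \<delta>) t = cd j (\<lambda>t. V \<delta> t - ?Y t) t"
      using smooth t by (simp add: curve_deriv_diff)
    also have "(\<lambda>t. V \<delta> t - ?Y t) = (\<lambda>t. V \<delta> t - D - \<delta> *\<^sub>R W t - (\<delta>\<^sup>2 / 2) *\<^sub>R Z t)"
      by (simp add: algebra_simps)
    finally show ?thesis
      using derivs_leD[OF K[OF h V W Z] le_refl t] \<delta> by simp
  qed
  then show "\<exists>K. \<forall>V D \<delta>. lie_quadratic_variation t0 t1 V D \<longrightarrow> norm D = d \<longrightarrow> \<delta> \<in> {0<..<1} \<longrightarrow>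
      (\<forall>t\<in>{t0..t1}. norm (curve_deriv t0 t1 j (V \<delta>) t
          - curve_deriv t0 t1 j (V_hat2 t0 t1 V \<delta>) t) \<le> K * \<delta> ^ 3)"
    by blast
qed

end
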